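(* Let $\mathcal{G}$ be a connected (undirected, weighted) graph on $N$ nodes with weights $\mathsf{a}_{ij}=\mathsf{a}_{ji}$. For each $i\in\{1,\dots,N\}$ let $f^i:\mathbb{R}^d\to\mathbb{R}$ be $m^i$-strongly convex ($m^i>0$) and differentiable on $\mathbb{R}^d$, with locally Lipschitz gradient. Let $\mathsf{x}^\star\in\mathbb{R}^d$ be the minimizer of $f=\sum_{i=1}^N f^i$. Then, for any $\alpha,\beta>0$, every initial condition $x^i(0),v^i(0)\in\mathbb{R}^d$, $i\in\{1,\dots,N\}$, with $\sum_{i=1}^N v^i(0)=0$, and each $i\in\{1,\dots,N\}$, the solution of $$\dot v^i=\alpha\beta\sum_{j=1}^N\mathsf{a}_{ij}(x^i-x^j),\qquad \dot x^i=-\alpha\nabla f^i(x^i)-\beta\sum_{j=1}^N\mathsf{a}_{ij}(x^i-x^j)-v^i,\qquad i\in\{1,\dots,N\},$$ satisfies $x^i(t)\to\mathsf{x}^\star$ exponentially fast as $t\to\infty$.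
   Context: A weighted graph on nodes $\{1,\dots,N\}$ ($N\ge 2$) has a nonnegative adjacency matrix $(\mathsf{a}_{ij})$ with $\mathsf{a}_{ij}>0$ iff $(i,j)$ is an edge and $\mathsf{a}_{ij}=0$ otherwise. Connected graph means undirected ($\mathsf{a}_{ij}=\mathsf{a}_{ji}$) with a path between every pair of nodes. A differentiable $f$ is $m$-strongly convex if $(z-x)^\top(\nabla f(z)-\nabla f(x))\ge m\|z-x\|^2$ for all $x,z$. Norms are Euclidean. Exponentially fast convergence $x^i(t)\to\mathsf{x}^\star$ means there are constants $C\ge0$, $r>0$ (which may depend on the initial condition) with $\|x^i(t)-\mathsf{x}^\star\|\le Ce^{-rt}$ for all $t\ge0$. *)

theory Defs
  imports "HOL-Analysis.Analysis"
begin

text \<open>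
  Nodes are the natural numbers in \<open>{1..N}\<close>, and the edges are read off the adjacency matrix:
  \<open>(i, j)\<close> is an edge iff \<open>a i j > 0\<close>. Values of \<open>a\<close> outside this range are irrelevant. Self-loops
  are not excluded.
\<close>

definition weighted_graph :: "nat \<Rightarrow> (nat \<Rightarrow> nat \<Rightarrow> real) \<Rightarrow> bool" where
  "weighted_graph N a \<longleftrightarrow> (\<forall>i\<in>{1..N}. \<forall>j\<in>{1..N}. a i j \<ge> 0)"

definition graph_edges :: "nat \<Rightarrow> (nat \<Rightarrow> nat \<Rightarrow> real) \<Rightarrow> (nat \<times> nat) set" where
  "graph_edges N a = {(i, j). i \<in> {1..N} \<and> j \<in> {1..N} \<and> a i j > 0}"

definition connected_graph :: "nat \<Rightarrow> (nat \<Rightarrow> nat \<Rightarrow> real) \<Rightarrow> bool" where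
  "connected_graph N a \<longleftrightarrow>
     weighted_graph N a \<and>
     (\<forall>i\<in>{1..N}. \<forall>j\<in>{1..N}. a i j = a j i) \<and>
     (\<forall>i\<in>{1..N}. \<forall>j\<in>{1..N}. (i, j) \<in> (graph_edges N a)\<^sup>*)"

text \<open>Meaningful only at points where \<open>f\<close> is differentiable.\<close>

definition gradient :: "('a::real_inner \<Rightarrow> real) \<Rightarrow> 'a \<Rightarrow> 'a" where
  "gradient f x = (THE D. GDERIV f x :> D)"

text \<open>First-order form of strong convexity, to be used for differentiable \<open>f\<close>.\<close>

definition strongly_convex :: "real \<Rightarrow> ('a::real_inner \<Rightarrow> real) \<Rightarrow> bool" where
  "strongly_convex m f \<longleftrightarrow>
     (\<forall>x z. (z - x) \<bullet> (gradient f z - gradient f x) \<ge> m * (norm (z - x))\<^sup>2)"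

text \<open>The library predicate \<open>local_lipschitz\<close> concerns time-dependent maps; here the map is
  constant in time.\<close>

definition locally_lipschitz :: "('a::metric_space \<Rightarrow> 'b::metric_space) \<Rightarrow> bool" where
  "locally_lipschitz g \<longleftrightarrow> local_lipschitz (UNIV :: real set) UNIV (\<lambda>_. g)"

text \<open>Forward solutions on \<open>[0, \<infinity>)\<close>; at time 0 the derivative is one-sided.\<close>

definition network_solution ::
  "nat \<Rightarrow> (nat \<Rightarrow> nat \<Rightarrow> real) \<Rightarrow> real \<Rightarrow> real \<Rightarrow> (nat \<Rightarrow> 'a::real_inner \<Rightarrow> real) \<Rightarrow>
   (nat \<Rightarrow> real \<Rightarrow> 'a) \<Rightarrow> (nat \<Rightarrow> real \<Rightarrow> 'a) \<Rightarrow> bool" where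
  "network_solution N a \<alpha> \<beta> f x v \<longleftrightarrow>
     (\<forall>i\<in>{1..N}. \<forall>t\<ge>0.
        (v i has_vector_derivative
           (\<alpha> * \<beta>) *\<^sub>R (\<Sum>j=1..N. a i j *\<^sub>R (x i t - x j t))) (at t within {0..}) \<and>
        (x i has_vector_derivative
           (- \<alpha> *\<^sub>R gradient (f i) (x i t)
            - \<beta> *\<^sub>R (\<Sum>j=1..N. a i j *\<^sub>R (x i t - x j t))
            - v i t)) (at t within {0..}))"

definition converges_exponentially :: "(real \<Rightarrow> 'a::real_normed_vector) \<Rightarrow> 'a \<Rightarrow> bool" where
  "converges_exponentially y p \<longleftrightarrow>
     (\<exists>C\<ge>0. \<exists>r>0. \<forall>t\<ge>0. norm (y t - p) \<le> C * exp (- r * t))"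

end

theory Submission
  imports
    Defs
    "HOL-Probability.Discrete_Topology"
    "Jordan_Normal_Form.Determinant"
begin

text \<open>
  Let \<open>g\<^sub>i\<close> be the gradient of \<open>f\<^sub>i\<close>, \<open>L\<close> the Laplacian, and put \<open>y\<^sub>i = x\<^sub>i - x\<^sup>*\<close>,
  \<open>w\<^sub>i = v\<^sub>i + \<alpha> g\<^sub>i(x\<^sup>*)\<close>, \<open>p\<^sub>i = g\<^sub>i(x\<^sub>i) - g\<^sub>i(x\<^sup>*)\<close>. Then \<open>w' = \<alpha>\<beta> L y\<close> and
  \<open>y' = - \<alpha> p - \<beta> L y - w\<close>. The sum of the \<open>w\<^sub>i\<close> stays \<open>0\<close>, so \<open>w\<close> lies in the range of \<open>L\<close>; with a
  right inverse \<open>B\<close> of \<open>L\<close> on that range, the energy \<open>|y|\<^sup>2 / 2 + (B w \<bullet> w) / (2 \<alpha> \<beta>)\<close> has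
  derivative \<open>- \<alpha> (y \<bullet> p) - \<beta> (y \<bullet> L y)\<close>, since the cross terms cancel.

  Only \<open>y \<bullet> p \<ge> 0\<close> is needed for the energy to decrease. This holds for the difference of two solutions,
  whence uniqueness. It also holds after the gradients are precomposed with the projection onto a ball
  around \<open>x\<^sup>*\<close>; the truncated system is globally Lipschitz, hence has a global solution, and if the radius
  is large compared with the initial energy this solution never leaves the ball, so it solves the original
  system. On the ball \<open>|p| \<le> K |y|\<close>, and strong convexity then makes the energy plus a small multiple of
  \<open>y \<bullet> w\<close> decay exponentially.
\<close>

section \<open>Global solutions of Lipschitz differential equations\<close>

text \<open>Integrating the exponential bound gains the factor \<open>1 / l\<close>. The bound
  serves twice: with a growth bound it shows that the fixed-point map below has bounded values, and
  with a Lipschitz bound it gives the contraction factor.\<close>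

lemma exp_weighted_integral_bound:
  fixes g :: "real \<Rightarrow> 'e::banach"
  assumes "l > 0" "t \<ge> 0" "continuous_on {0..t} g"
    and g: "\<And>s. s \<in> {0..t} \<Longrightarrow> norm (g s) \<le> B * exp (l * s)"
  shows "norm (exp (- l * t) *\<^sub>R integral {0..t} g) \<le> B / l"
proof -
  have I: "((\<lambda>s. B * exp (l * s)) has_integral (B / l * exp (l * t) - B / l * exp (l * 0))) {0..t}"
    using \<open>t \<ge> 0\<close> \<open>l > 0\<close>
    by (intro fundamental_theorem_of_calculus)
       (auto intro!: derivative_eq_intros simp flip: has_real_derivative_iff_has_vector_derivative)
  have B0: "B \<ge> 0"
    using order_trans[OF norm_ge_zero g[of 0]] \<open>t \<ge> 0\<close> by simp
  have "norm (integral {0..t} g) \<le> integral {0..t} (\<lambda>s. B * exp (l * s))"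
    using assms I
    by (intro integral_norm_bound_integral integrable_continuous_real) (auto intro!: continuous_intros)
  also have "\<dots> = B / l * exp (l * t) - B / l * exp (l * 0)"
    using I by (rule integral_unique)
  also have "\<dots> \<le> B / l * exp (l * t)"
    using B0 \<open>l > 0\<close> by simp
  finally have "exp (- l * t) * norm (integral {0..t} g) \<le> exp (- l * t) * (B / l * exp (l * t))"
    by (intro mult_left_mono) auto
  also have "\<dots> = B / l"
    by (simp add: exp_minus field_simps)
  finally show ?thesis by simp
qed

text \<open>A solution is written as \<open>s0 + exp (2 K t) z t\<close> with \<open>z\<close> bounded: for the unknown \<open>z\<close> the
  integral equation is a contraction with factor one half on all of \<open>[0, \<infinity>)\<close> at once.\<close>

lemma lipschitz_global_solution:
  fixes F :: "'e::banach \<Rightarrow> 'e"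
  assumes "L-lipschitz_on UNIV F"
  shows "\<exists>s. s 0 = s0 \<and> (\<forall>t\<ge>0. (s has_vector_derivative F (s t)) (at t within {0..}))"
proof -
  \<comment> \<open>\<open>L\<close> may be \<open>0\<close>, while the weight \<open>l\<close> is
    divided by later and must be positive.\<close>
  define K where "K = L + 1"
  have K: "K > 0" and FK: "K-lipschitz_on UNIV F"
    using lipschitz_on_nonneg[OF assms] lipschitz_on_le[OF assms, of K] unfolding K_def by auto
  have FD: "norm (F u - F w) \<le> K * norm (u - w)" for u w
    using lipschitz_onD[OF FK, of u w] by (simp add: dist_norm)
  have contF: "continuous_on UNIV F"
    using FK by (rule lipschitz_on_continuous_on)
  define l where "l = 2 * K"
  have l: "l > 0" using K by (simp add: l_def)
  define S where "S z t = s0 + exp (l * t) *\<^sub>R apply_bcontfun z t" for z :: "real \<Rightarrow>\<^sub>C 'e" and t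
  define I where "I z t = integral {0..t} (\<lambda>\<tau>. F (S z \<tau>))" for z t
  have contS: "continuous_on A (S z)" for A z
    unfolding S_def by (intro continuous_intros) auto
  have contFS: "continuous_on A (\<lambda>t. F (S z t))" for A z
    by (rule continuous_on_compose2[OF contF contS]) auto
  have derI: "(I z has_vector_derivative F (S z t)) (at t within {0..})" if "t \<ge> 0" for z t
  proof -
    have "(I z has_vector_derivative F (S z t)) (at t within {0..t+1})"
      unfolding I_def using that by (intro integral_has_vector_derivative contFS) auto
    \<comment> \<open>The right end \<open>t + 1\<close> lies beyond \<open>t\<close>, so near
      \<open>t\<close> the compact interval and the half-line coincide.\<close>
    moreover have "at t within {0..} = at t within {0..t+1}"
      using that by (intro at_within_nhd[of _ "{..<t+1}"]) auto
    ultimately show ?thesis by simp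
  qed
  have contI: "continuous_on {0..} (I z)" for z
    by (rule continuous_on_vector_derivative[OF derI]) simp
  \<comment> \<open>Elements of the function space live on the whole line; \<open>max 0 t\<close>
    extends the map continuously by \<open>0\<close> to negative times.\<close>
  define T where "T z t = exp (- l * max 0 t) *\<^sub>R I z (max 0 t)" for z t
  have bound: "norm (F (S z t)) \<le> (norm (F s0) + K * norm z) * exp (l * t)" if "t \<ge> 0" for z t
  proof -
    have "norm (F (S z t)) \<le> norm (F s0) + norm (F (S z t) - F s0)"
      by (metis norm_triangle_sub)
    also have "\<dots> \<le> norm (F s0) * exp (l * t) + K * (exp (l * t) * norm z)"
    proof (intro add_mono)
      show "norm (F s0) \<le> norm (F s0) * exp (l * t)"
        using l that by (simp add: mult_le_cancel_left1)
      have "norm (F (S z t) - F s0) \<le> K * norm (exp (l * t) *\<^sub>R apply_bcontfun z t)"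
        using FD[of "S z t" s0] by (simp add: S_def)
      also have "\<dots> \<le> K * (exp (l * t) * norm z)"
        using K by (auto intro!: mult_left_mono norm_bounded)
      finally show "norm (F (S z t) - F s0) \<le> K * (exp (l * t) * norm z)" .
    qed
    finally show ?thesis by (simp add: algebra_simps)
  qed
  have diff: "norm (F (S z t) - F (S w t)) \<le> (K * dist z w) * exp (l * t)" for z w t
  proof -
    have "norm (F (S z t) - F (S w t)) \<le> K * norm (exp (l * t) *\<^sub>R (apply_bcontfun z t - apply_bcontfun w t))"
      using FD[of "S z t" "S w t"] by (simp add: S_def algebra_simps)
    also have "\<dots> \<le> K * (exp (l * t) * dist z w)"
      using K dist_bounded[of z t w] by (auto intro!: mult_left_mono simp: dist_norm)
    finally show ?thesis by (simp add: algebra_simps)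
  qed
  have TB: "T z \<in> bcontfun" for z
  proof (rule bcontfun_normI)
    have "continuous_on UNIV (\<lambda>t. I z (max 0 t))"
      by (rule continuous_on_compose2[OF contI]) (auto intro!: continuous_intros)
    then show "continuous_on UNIV (T z)"
      unfolding T_def by (intro continuous_intros)
    show "norm (T z t) \<le> (norm (F s0) + K * norm z) / l" for t
      unfolding T_def I_def using l by (intro exp_weighted_integral_bound contFS bound) auto
  qed
  define \<Theta> where "\<Theta> z = Bcontfun (T z)" for z
  have app: "apply_bcontfun (\<Theta> z) = T z" for z
    using TB by (simp add: \<Theta>_def Bcontfun_inverse)
  have "dist (\<Theta> z) (\<Theta> w) \<le> 1/2 * dist z w" for z w
  proof (rule dist_bound)
    fix t
    have "T z t - T w t = exp (- l * max 0 t) *\<^sub>R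
        integral {0..max 0 t} (\<lambda>\<tau>. F (S z \<tau>) - F (S w \<tau>))"
      unfolding T_def I_def
      by (subst integral_diff) (auto intro!: integrable_continuous_real contFS simp: scaleR_diff_right)
    moreover have "norm \<dots> \<le> K * dist z w / l"
      using l by (intro exp_weighted_integral_bound continuous_on_diff contFS diff) auto
    ultimately show "dist (apply_bcontfun (\<Theta> z) t) (apply_bcontfun (\<Theta> w) t) \<le> 1/2 * dist z w"
      using K by (simp add: app dist_norm l_def)
  qed
  then obtain z where z: "\<Theta> z = z"
    using banach_fix_type[of "1/2" \<Theta>] by auto
  have S: "S z t = s0 + I z t" if "t \<ge> 0" for t
  proof -
    have "apply_bcontfun z t = exp (- l * t) *\<^sub>R I z t"
      using app[of z] z that by (simp add: T_def)
    then show ?thesis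
      unfolding S_def by (simp flip: exp_add)
  qed
  have "(S z has_vector_derivative F (S z t)) (at t within {0..})" if "t \<ge> 0" for t
  proof -
    have "((\<lambda>t. s0 + I z t) has_vector_derivative F (S z t)) (at t within {0..})"
      using derI[OF that, of z] by (auto intro!: derivative_eq_intros)
    then show ?thesis
      by (rule has_vector_derivative_transform[rotated 2]) (use that S in auto)
  qed
  moreover have "S z 0 = s0"
    using S[of 0] by (simp add: I_def)
  ultimately show ?thesis by blast
qed

instance bcontfun :: (metric_space, banach) banach ..

text \<open>The bounded functions on a discrete index type are the Banach space in which the preceding lemma
  is applied; components outside \<open>A\<close> are frozen at \<open>0\<close>.\<close>

lemma lipschitz_global_solution_family:
  fixes F :: "'i \<Rightarrow> ('i \<Rightarrow> 'e::banach) \<Rightarrow> 'e" and c :: "'i \<Rightarrow> 'e"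
  assumes "finite A"
    and lip: "\<And>i s s'. i \<in> A \<Longrightarrow> norm (F i s - F i s') \<le> L i * (\<Sum>j\<in>A. norm (s j - s' j))"
    and L0: "\<And>i. i \<in> A \<Longrightarrow> L i \<ge> 0"
  shows "\<exists>s. \<forall>i\<in>A. s i 0 = c i \<and>
    (\<forall>t\<ge>0. (s i has_vector_derivative F i (\<lambda>j. s j t)) (at t within {0..}))"
proof -
  define E :: "('i \<Rightarrow> 'e) \<Rightarrow> 'i discrete \<Rightarrow>\<^sub>C 'e"
    where "E h = Bcontfun (\<lambda>d. if of_discrete d \<in> A then h (of_discrete d) else 0)" for h
  define V :: "('i discrete \<Rightarrow>\<^sub>C 'e) \<Rightarrow> 'i \<Rightarrow> 'e"
    where "V s i = apply_bcontfun s (discrete i)" for s i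
  have fin: "(\<lambda>d. if of_discrete d \<in> A then h (of_discrete d) else 0) \<in> bcontfun" for h :: "'i \<Rightarrow> 'e"
  proof (rule bcontfun_normI)
    show "norm (if of_discrete d \<in> A then h (of_discrete d) else 0) \<le> (\<Sum>i\<in>A. norm (h i))" for d
      using \<open>finite A\<close> by (auto intro!: member_le_sum sum_nonneg)
    show "continuous_on UNIV (\<lambda>d. if of_discrete d \<in> A then h (of_discrete d) else 0)"
      by (auto simp: continuous_on_open_vimage open_discrete)
  qed
  have E: "apply_bcontfun (E h) d = (if of_discrete d \<in> A then h (of_discrete d) else 0)" for h d
    using fin[of h] by (simp add: E_def Bcontfun_inverse)
  have VE: "V (E h) i = h i" if "i \<in> A" for h i
    using that by (simp add: V_def E discrete_inverse)
  \<comment> \<open>A crude constant: each \<open>L i\<close> is bounded by the sum of all of them,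
    and each of the \<open>card A\<close> component differences by the sup distance.\<close>
  have "((\<Sum>i\<in>A. L i) * card A)-lipschitz_on UNIV (\<lambda>s. E (\<lambda>i. F i (V s)))"
  proof (rule lipschitz_onI)
    fix s s' :: "'i discrete \<Rightarrow>\<^sub>C 'e"
    show "dist (E (\<lambda>i. F i (V s))) (E (\<lambda>i. F i (V s'))) \<le> ((\<Sum>i\<in>A. L i) * card A) * dist s s'"
    proof (rule dist_bound)
      fix d
      show "dist (apply_bcontfun (E (\<lambda>i. F i (V s))) d) (apply_bcontfun (E (\<lambda>i. F i (V s'))) d)
        \<le> ((\<Sum>i\<in>A. L i) * card A) * dist s s'"
      proof (cases "of_discrete d \<in> A")
        case True
        let ?i = "of_discrete d"
        have "norm (F ?i (V s) - F ?i (V s')) \<le> L ?i * (\<Sum>j\<in>A. norm (V s j - V s' j))"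
          using True by (rule lip)
        also have "\<dots> \<le> (\<Sum>i\<in>A. L i) * (\<Sum>j\<in>A. dist s s')"
          using True \<open>finite A\<close> L0
          by (intro mult_mono sum_mono member_le_sum sum_nonneg)
             (auto simp: V_def dist_bounded simp flip: dist_norm)
        finally show ?thesis using True by (simp add: E dist_norm mult.assoc)
      qed (use L0 in \<open>simp add: E sum_nonneg\<close>)
    qed
  qed (simp add: L0 sum_nonneg)
  from lipschitz_global_solution[OF this, of "E c"] obtain s where
    s0: "s 0 = E c" and
    s: "\<And>t. t \<ge> 0 \<Longrightarrow> (s has_vector_derivative E (\<lambda>i. F i (V (s t)))) (at t within {0..})"
    by auto
  \<comment> \<open>Evaluation at an index is bounded and linear, so a derivative in the sup norm
    yields the derivative of each component.\<close>
  have bl: "bounded_linear (\<lambda>s. V s i)" for i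
    by (rule bounded_linear_intro[where K=1]) (auto simp: V_def norm_bounded)
  have "((\<lambda>t. V (s t) i) has_vector_derivative F i (V (s t))) (at t within {0..})"
    if "i \<in> A" "t \<ge> 0" for i t
    using bounded_linear.has_vector_derivative[OF bl s[OF that(2)], of i] that by (simp add: VE)
  then show ?thesis
    using s0 by (intro exI[of _ "\<lambda>i t. V (s t) i"]) (auto simp: VE)
qed

section \<open>The Laplacian of a connected graph\<close>

text \<open>The coupling term of \<open>network_solution\<close>. Polymorphic values let the same
  operator act on the states and on real columns of a matrix.\<close>

definition laplacian :: "nat \<Rightarrow> (nat \<Rightarrow> nat \<Rightarrow> real) \<Rightarrow> (nat \<Rightarrow> 'a::real_vector) \<Rightarrow> nat \<Rightarrow> 'a" where
  "laplacian N a u i = (\<Sum>j=1..N. a i j *\<^sub>R (u i - u j))"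

lemma laplacian_diff: "laplacian N a (\<lambda>i. u i - w i) i = laplacian N a u i - laplacian N a w i"
  unfolding laplacian_def sum_subtractf[symmetric] by (intro sum.cong) (auto simp: algebra_simps)

lemma laplacian_const: "laplacian N a (\<lambda>i. c) i = 0"
  by (simp add: laplacian_def)

lemma laplacian_cong: "\<lbrakk>\<And>j. j \<in> {1..N} \<Longrightarrow> u j = w j; i \<in> {1..N}\<rbrakk> \<Longrightarrow> laplacian N a u i = laplacian N a w i"
  by (auto simp: laplacian_def intro!: sum.cong)

locale connected_network =
  fixes N :: nat and a :: "nat \<Rightarrow> nat \<Rightarrow> real"
  assumes conn: "connected_graph N a"
begin

section \<open>The quadratic form of the Laplacian and its spectral bounds\<close>

lemma a_nonneg: "i \<in> {1..N} \<Longrightarrow> j \<in> {1..N} \<Longrightarrow> a i j \<ge> 0"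
  and a_sym: "i \<in> {1..N} \<Longrightarrow> j \<in> {1..N} \<Longrightarrow> a i j = a j i"
  and a_conn: "i \<in> {1..N} \<Longrightarrow> j \<in> {1..N} \<Longrightarrow> (i, j) \<in> (graph_edges N a)\<^sup>*"
  using conn by (auto simp: connected_graph_def weighted_graph_def)

text \<open>Exchanging \<open>i\<close> and \<open>j\<close> preserves the weights by symmetry;
  averaging the two expressions gives a form symmetric in \<open>u\<close> and \<open>w\<close>.
  Self-adjointness, positivity and the vanishing sum all follow from it.\<close>

lemma sum_inner_laplacian:
  fixes u w :: "nat \<Rightarrow> 'a::real_inner"
  shows "(\<Sum>i=1..N. u i \<bullet> laplacian N a w i) =
    (\<Sum>i=1..N. \<Sum>j=1..N. a i j * ((u i - u j) \<bullet> (w i - w j))) / 2"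
proof -
  let ?S = "\<lambda>f. \<Sum>i=1..N. \<Sum>j=1..N. a i j * f i j"
  have "?S (\<lambda>i j. u i \<bullet> (w i - w j)) = (\<Sum>j=1..N. \<Sum>i=1..N. a i j * (u i \<bullet> (w i - w j)))"
    by (rule sum.swap)
  also have "\<dots> = ?S (\<lambda>i j. u j \<bullet> (w j - w i))"
    using a_sym by (auto intro!: sum.cong)
  finally have *: "?S (\<lambda>i j. u i \<bullet> (w i - w j)) = ?S (\<lambda>i j. u j \<bullet> (w j - w i))" .
  have "?S (\<lambda>i j. (u i - u j) \<bullet> (w i - w j)) = ?S (\<lambda>i j. u i \<bullet> (w i - w j)) + ?S (\<lambda>i j. u j \<bullet> (w j - w i))"
    by (simp add: inner_diff_left inner_diff_right algebra_simps flip: sum.distrib)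
  also have "\<dots> = 2 * ?S (\<lambda>i j. u i \<bullet> (w i - w j))"
    using * by simp
  finally show ?thesis
    by (simp add: laplacian_def inner_sum_right)
qed

lemma sum_inner_laplacian_commute:
  fixes u w :: "nat \<Rightarrow> 'a::real_inner"
  shows "(\<Sum>i=1..N. u i \<bullet> laplacian N a w i) =
    (\<Sum>i=1..N. laplacian N a u i \<bullet> w i)"
proof -
  have "(\<Sum>i=1..N. laplacian N a u i \<bullet> w i) = (\<Sum>i=1..N. w i \<bullet> laplacian N a u i)"
    by (simp add: inner_commute)
  then show ?thesis
    unfolding sum_inner_laplacian by (simp add: inner_commute)
qed

lemma sum_inner_laplacian_nonneg:
  fixes u :: "nat \<Rightarrow> 'a::real_inner"
  shows "(\<Sum>i=1..N. u i \<bullet> laplacian N a u i) \<ge> 0"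
  unfolding sum_inner_laplacian using a_nonneg by (auto intro!: divide_nonneg_nonneg sum_nonneg mult_nonneg_nonneg)

text \<open>The form vanishes if one argument is constant, so the sum is orthogonal to every
  vector.\<close>

lemma sum_laplacian:
  fixes u :: "nat \<Rightarrow> 'a::real_inner"
  shows "(\<Sum>i=1..N. laplacian N a u i) = 0"
proof -
  have "x \<bullet> (\<Sum>i=1..N. laplacian N a u i) = 0" for x
    using sum_inner_laplacian[of "\<lambda>_. x" u] by (simp add: inner_sum_right)
  from this[of "\<Sum>i=1..N. laplacian N a u i"] show ?thesis by simp
qed

text \<open>Plays the role of a bound by the largest eigenvalue. Each weight is split into two
  square roots before Cauchy-Schwarz, and the total weight \<open>D\<close> dominates every row sum;
  the \<open>+ 1\<close> makes the constant positive.\<close>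

lemma sum_norm_laplacian_le:
  obtains \<Lambda> where "\<Lambda> > 0" and
    "\<And>u :: nat \<Rightarrow> 'a::real_inner. (\<Sum>i=1..N. (norm (laplacian N a u i))\<^sup>2) \<le> \<Lambda> * (\<Sum>i=1..N. u i \<bullet> laplacian N a u i)"
proof
  define D where "D = (\<Sum>i=1..N. \<Sum>j=1..N. a i j)"
  have D: "D \<ge> 0" unfolding D_def using a_nonneg by (auto intro!: sum_nonneg)
  show "2 * D + 1 > 0" using D by simp
  fix u :: "nat \<Rightarrow> 'a"
  have "(norm (laplacian N a u i))\<^sup>2 \<le> D * (\<Sum>j=1..N. a i j * ((u i - u j) \<bullet> (u i - u j)))" (is "_ \<le> D * ?R")
    if i: "i \<in> {1..N}" for i
  proof -
    have "norm (laplacian N a u i) \<le> (\<Sum>j=1..N. sqrt (a i j) * (sqrt (a i j) * norm (u i - u j)))"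
      unfolding laplacian_def using a_nonneg[OF i] by (intro sum_norm_le) (simp flip: mult.assoc)
    then have "(norm (laplacian N a u i))\<^sup>2 \<le> (\<Sum>j=1..N. sqrt (a i j) * (sqrt (a i j) * norm (u i - u j)))\<^sup>2"
      by (intro power_mono) auto
    also have "\<dots> \<le> (\<Sum>j=1..N. (sqrt (a i j))\<^sup>2) * (\<Sum>j=1..N. (sqrt (a i j) * norm (u i - u j))\<^sup>2)"
      by (rule Cauchy_Schwarz_ineq_sum)
    also have "\<dots> = (\<Sum>j=1..N. a i j) * ?R"
      using a_nonneg[OF i] by (simp add: power_mult_distrib power2_norm_eq_inner)
    also have "\<dots> \<le> D * ?R"
      unfolding D_def using i a_nonneg
      by (intro mult_right_mono member_le_sum[of i "{1..N}" "\<lambda>i. \<Sum>j=1..N. a i j"] sum_nonneg) auto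
    finally show ?thesis .
  qed
  then have "(\<Sum>i=1..N. (norm (laplacian N a u i))\<^sup>2) \<le> (\<Sum>i=1..N. D * (\<Sum>j=1..N. a i j * ((u i - u j) \<bullet> (u i - u j))))"
    by (rule sum_mono)
  also have "\<dots> = 2 * D * (\<Sum>i=1..N. u i \<bullet> laplacian N a u i)"
    unfolding sum_inner_laplacian by (simp add: sum_distrib_left mult_ac)
  also have "\<dots> \<le> (2 * D + 1) * (\<Sum>i=1..N. u i \<bullet> laplacian N a u i)"
    using sum_inner_laplacian_nonneg[of u] by (intro mult_right_mono) auto
  finally show "(\<Sum>i=1..N. (norm (laplacian N a u i))\<^sup>2) \<le> (2 * D + 1) * (\<Sum>i=1..N. u i \<bullet> laplacian N a u i)" .
qed

text \<open>Induction along a path from \<open>i\<close> to \<open>j\<close>: each edge is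
  controlled by its own term of the form. The constant depends on the nodes and the weights but not
  on \<open>u\<close>.\<close>

lemma norm_diff_le_laplacian_form:
  assumes "i \<in> {1..N}" "j \<in> {1..N}"
  obtains C where "C \<ge> 0" and
    "\<And>u :: nat \<Rightarrow> 'a::real_inner. (norm (u i - u j))\<^sup>2 \<le> C * (\<Sum>k=1..N. u k \<bullet> laplacian N a u k)"
proof -
  have "\<exists>C\<ge>0. \<forall>u :: nat \<Rightarrow> 'a. (norm (u i - u j))\<^sup>2 \<le> C * (\<Sum>k=1..N. u k \<bullet> laplacian N a u k)"
    using a_conn[OF assms]
  proof (induction rule: rtrancl_induct)
    case base
    show ?case by (auto intro!: exI[of _ 0])
  next
    case (step j k)
    then have jk: "j \<in> {1..N}" "k \<in> {1..N}" "a j k > 0"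
      by (auto simp: graph_edges_def)
    obtain C where C: "C \<ge> 0"
      "\<And>u :: nat \<Rightarrow> 'a. (norm (u i - u j))\<^sup>2 \<le> C * (\<Sum>k=1..N. u k \<bullet> laplacian N a u k)"
      using step.IH by blast
    \<comment> \<open>The new edge costs \<open>2 / a j k\<close> times the form, and squaring the
      triangle inequality doubles both contributions.\<close>
    have "(norm (u i - u k))\<^sup>2 \<le> (2 * C + 4 / a j k) * (\<Sum>k=1..N. u k \<bullet> laplacian N a u k)" for u :: "nat \<Rightarrow> 'a"
    proof -
      let ?E = "\<Sum>k=1..N. u k \<bullet> laplacian N a u k"
      have nn: "0 \<le> (\<Sum>l=Suc 0..N. a i l * ((u i - u l) \<bullet> (u i - u l)))" if "Suc 0 \<le> i \<and> i \<le> N \<and> i \<noteq> j" for i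
        using a_nonneg that by (intro sum_nonneg mult_nonneg_nonneg) auto
      have "a j k * (norm (u j - u k))\<^sup>2 \<le> (\<Sum>l=1..N. a j l * ((u j - u l) \<bullet> (u j - u l)))"
        unfolding power2_norm_eq_inner using jk a_nonneg
        by (intro member_le_sum[of k _ "\<lambda>l. a j l * ((u j - u l) \<bullet> (u j - u l))"]) auto
      also have "\<dots> \<le> 2 * ?E"
        unfolding sum_inner_laplacian using jk a_nonneg
        using member_le_sum[of j "{1..N}" "\<lambda>i. \<Sum>l=1..N. a i l * ((u i - u l) \<bullet> (u i - u l))"]
        by (simp add: nn)
      finally have e: "(norm (u j - u k))\<^sup>2 \<le> 2 / a j k * ?E"
        using jk by (simp add: field_simps)
      have "(norm (u i - u k))\<^sup>2 \<le> (norm (u i - u j) + norm (u j - u k))\<^sup>2"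
        by (intro power_mono) (auto intro: norm_triangle_le simp: order_trans[OF _ norm_triangle_ineq, of _ "u i - u j" "u j - u k"])
      also have "\<dots> \<le> 2 * (norm (u i - u j))\<^sup>2 + 2 * (norm (u j - u k))\<^sup>2"
        using sum_squares_bound[of "norm (u i - u j)" "norm (u j - u k)"] by (simp add: power2_sum)
      also have "\<dots> \<le> 2 * (C * ?E) + 2 * (2 / a j k * ?E)"
        using C(2)[of u] e by (intro add_mono mult_left_mono) auto
      finally show ?thesis by (simp add: algebra_simps)
    qed
    then show ?case
      using C(1) jk by (intro exI[of _ "2 * C + 4 / a j k"]) auto
  qed
  then show ?thesis using that by blast
qed

text \<open>Plays the role of the spectral gap. Since \<open>laplacian N a u\<close> has zero sum,
  \<open>u\<close> may be replaced by \<open>u - u 1\<close>; Cauchy-Schwarz and the path bound then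
  give \<open>E * E \<le> E * (C * S)\<close>, from which \<open>E\<close> is cancelled.\<close>

lemma laplacian_form_le_sum_norm:
  obtains C where "C > 0" and
    "\<And>u :: nat \<Rightarrow> 'a::real_inner. (\<Sum>i=1..N. u i \<bullet> laplacian N a u i) \<le> C * (\<Sum>i=1..N. (norm (laplacian N a u i))\<^sup>2)"
proof -
  have "\<exists>C. \<forall>i\<in>{1..N}. C i \<ge> 0 \<and> (\<forall>u :: nat \<Rightarrow> 'a. (norm (u i - u 1))\<^sup>2 \<le> C i * (\<Sum>k=1..N. u k \<bullet> laplacian N a u k))"
  proof (rule bchoice, rule ballI)
    fix i assume "i \<in> {1..N}"
    then obtain C where "C \<ge> 0" "\<And>u :: nat \<Rightarrow> 'a. (norm (u i - u 1))\<^sup>2 \<le> C * (\<Sum>k=1..N. u k \<bullet> laplacian N a u k)"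
      using norm_diff_le_laplacian_form[of i 1, where 'a='a] by auto
    then show "\<exists>C. C \<ge> 0 \<and> (\<forall>u :: nat \<Rightarrow> 'a. (norm (u i - u 1))\<^sup>2 \<le> C * (\<Sum>k=1..N. u k \<bullet> laplacian N a u k))"
      by blast
  qed
  then obtain C where C: "\<And>i. i \<in> {1..N} \<Longrightarrow> C i \<ge> 0"
    "\<And>i u :: nat \<Rightarrow> 'a. i \<in> {1..N} \<Longrightarrow> (norm (u i - u 1))\<^sup>2 \<le> C i * (\<Sum>k=1..N. u k \<bullet> laplacian N a u k)"
    by blast
  let ?C = "(\<Sum>i=1..N. C i) + 1"
  have C0: "?C > 0" using C(1) by (smt (verit) sum_nonneg)
  have "(\<Sum>i=1..N. u i \<bullet> laplacian N a u i) \<le> ?C * (\<Sum>i=1..N. (norm (laplacian N a u i))\<^sup>2)" for u :: "nat \<Rightarrow> 'a"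
  proof -
    define E where "E = (\<Sum>i=1..N. u i \<bullet> laplacian N a u i)"
    define S where "S = (\<Sum>i=1..N. (norm (laplacian N a u i))\<^sup>2)"
    have E0: "E \<ge> 0" unfolding E_def by (rule sum_inner_laplacian_nonneg)
    have S0: "S \<ge> 0" unfolding S_def by (intro sum_nonneg) auto
    have "E = (\<Sum>i=1..N. (u i - u 1) \<bullet> laplacian N a u i)"
      unfolding E_def using sum_laplacian[of u] by (simp add: inner_diff_left sum_subtractf flip: inner_sum_right)
    also have "\<dots> \<le> (\<Sum>i=1..N. norm (u i - u 1) * norm (laplacian N a u i))"
      by (intro sum_mono norm_cauchy_schwarz)
    finally have "E\<^sup>2 \<le> (\<Sum>i=1..N. norm (u i - u 1) * norm (laplacian N a u i))\<^sup>2"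
      using E0 by (rule power_mono)
    also have "\<dots> \<le> (\<Sum>i=1..N. (norm (u i - u 1))\<^sup>2) * S"
      unfolding S_def by (rule Cauchy_Schwarz_ineq_sum)
    also have "\<dots> \<le> (\<Sum>i=1..N. C i * E) * S"
      unfolding E_def using S0 C(2) by (intro mult_right_mono sum_mono) auto
    also have "\<dots> \<le> E * (?C * S)"
      using E0 S0 by (simp add: algebra_simps flip: sum_distrib_left)
    finally have "E * E \<le> E * (?C * S)" by (simp add: power2_eq_square)
    moreover have "0 \<le> ?C * S" using C0 S0 by simp
    ultimately have "E \<le> ?C * S"
      using E0 by (cases "E = 0") auto
    then show ?thesis unfolding E_def S_def .
  qed
  then show ?thesis using that C0 by blast
qed

lemma laplacian_eq_zero_imp_const:
  fixes u :: "nat \<Rightarrow> 'a::real_inner"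
  assumes "\<And>i. i \<in> {1..N} \<Longrightarrow> laplacian N a u i = 0" and ij: "i \<in> {1..N}" "j \<in> {1..N}"
  shows "u i = u j"
proof -
  have "(\<Sum>k=1..N. u k \<bullet> laplacian N a u k) = 0"
    using assms(1) by simp
  moreover obtain C where "(norm (u i - u j))\<^sup>2 \<le> C * (\<Sum>k=1..N. u k \<bullet> laplacian N a u k)"
    using norm_diff_le_laplacian_form[OF ij, where 'a='a] by metis
  ultimately have "(norm (u i - u j))\<^sup>2 \<le> 0"
    by simp
  then show ?thesis
    by simp
qed

text \<open>Adding the all-ones matrix makes the Laplacian invertible, and the inverse inverts the Laplacian
  on the vectors with zero sum.\<close>

lemma laplacian_right_inverse:
  obtains B :: "nat \<Rightarrow> nat \<Rightarrow> real" where
    "\<And>(w :: nat \<Rightarrow> 'a::real_vector) i. \<lbrakk>(\<Sum>k=1..N. w k) = 0; i \<in> {1..N}\<rbrakk> \<Longrightarrow>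
       laplacian N a (\<lambda>i. \<Sum>k=1..N. B i k *\<^sub>R w k) i = w i"
proof (cases "N = 0")
  case False
  \<comment> \<open>Matrix indices start at \<open>0\<close> and nodes at \<open>1\<close>, hence
    the shifts by \<open>Suc\<close> here and by \<open>- 1\<close> below.\<close>
  define A where "A = mat N N (\<lambda>(i, j). (if i = j then \<Sum>k=1..N. a (Suc i) k else 0) - a (Suc i) (Suc j) + 1)"
  have A: "A \<in> carrier_mat N N" by (simp add: A_def)
  have Av: "vec_index (A *\<^sub>v v) i = laplacian N a (\<lambda>k. vec_index v (k - 1)) (Suc i) + (\<Sum>k=1..N. vec_index v (k - 1))"
    if "v \<in> carrier_vec N" "i < N" for v i
  proof -
    have sh: "(\<Sum>k=1..N. g k) = (\<Sum>j<N. g (Suc j))" for g :: "nat \<Rightarrow> real"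
      by (simp add: sum.atLeast1_atMost_eq)
    have "vec_index (A *\<^sub>v v) i = (\<Sum>j<N. ((if i = j then \<Sum>k=1..N. a (Suc i) k else 0) - a (Suc i) (Suc j) + 1) * vec_index v j)"
      using that by (auto simp: A_def scalar_prod_def atLeast0LessThan intro!: sum.cong)
    also have "\<dots> = (\<Sum>j<N. if i = j then (\<Sum>k=1..N. a (Suc i) k) * vec_index v j else 0)
        - (\<Sum>j<N. a (Suc i) (Suc j) * vec_index v j) + (\<Sum>j<N. vec_index v j)"
      unfolding sum_subtractf[symmetric] sum.distrib[symmetric] by (intro sum.cong) (auto simp: algebra_simps)
    also have "(\<Sum>j<N. if i = j then (\<Sum>k=1..N. a (Suc i) k) * vec_index v j else 0) = (\<Sum>k=1..N. a (Suc i) k) * vec_index v i"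
      using that by simp
    finally show ?thesis
      unfolding laplacian_def sh by (simp add: algebra_simps sum_subtractf sum_distrib_left)
  qed
  \<comment> \<open>Summing all rows kills the Laplacian and leaves \<open>N\<close> copies of the
    sum of \<open>u\<close>.\<close>
  have sum0: "(\<Sum>k=1..N. u k) = c / N" if "\<And>i. i \<in> {1..N} \<Longrightarrow> laplacian N a u i + (\<Sum>k=1..N. u k) = d i" "(\<Sum>i=1..N. d i) = c" for u d c
  proof -
    have "(\<Sum>i=1..N. laplacian N a u i + (\<Sum>k=1..N. u k)) = c"
      unfolding that(2)[symmetric] using that(1) by (intro sum.cong) auto
    then show ?thesis
      using sum_laplacian[of u] False by (simp add: sum.distrib field_simps)
  qed
  \<comment> \<open>A kernel vector has zero sum by \<open>sum0\<close>, so it lies in the kernel of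
    the Laplacian and is constant; a constant with zero sum is \<open>0\<close>.\<close>
  have "v = 0\<^sub>v N" if v: "v \<in> carrier_vec N" and Av0: "A *\<^sub>v v = 0\<^sub>v N" for v
  proof -
    define u where "u = (\<lambda>k. vec_index v (k - 1))"
    have *: "laplacian N a u i + (\<Sum>k=1..N. u k) = 0" if "i \<in> {1..N}" for i
    proof -
      have "i - 1 < N" "Suc (i - 1) = i" using that by auto
      then show ?thesis
        using Av[OF v, of "i - 1"] Av0 by (simp add: u_def)
    qed
    have s0: "(\<Sum>k=1..N. u k) = 0"
      using sum0[of u "\<lambda>_. 0" 0] * by simp
    have c: "u i = u 1" if "i \<in> {1..N}" for i
      by (rule laplacian_eq_zero_imp_const) (use * s0 that in auto)
    have "(\<Sum>k=1..N. u k) = (\<Sum>k=1..N. u 1)"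
      by (intro sum.cong refl c)
    then have "u 1 = 0"
      using s0 False by simp
    then have "u (Suc i) = 0" if "i < N" for i
      using c[of "Suc i"] that by simp
    then show ?thesis
      using v by (intro eq_vecI) (auto simp: u_def)
  qed
  then have "det A \<noteq> 0"
    using det_0_iff_vec_prod_zero_field[OF A] by blast
  then obtain B' where B': "B' \<in> carrier_mat N N" "A * B' = 1\<^sub>m N"
    using det_non_zero_imp_unit[OF A, of "()"] by (auto simp: Units_def ring_mat_def)
  define B where "B i k = B' $$ (i - 1, k - 1)" for i k
  \<comment> \<open>Every column of the inverse sums to \<open>1 / N\<close>, so the Laplacian sends
    it to a unit vector minus its mean. The mean disappears when paired with a \<open>w\<close> of
    zero sum.\<close>
  have B: "laplacian N a (\<lambda>i. B i k) i = (if i = k then 1 else 0) - 1 / N" if ik: "i \<in> {1..N}" "k \<in> {1..N}" for i k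
  proof -
    have *: "laplacian N a (\<lambda>i. B i k) j + (\<Sum>i=1..N. B i k) = (if j = k then 1 else 0)" if j: "j \<in> {1..N}" for j
    proof -
      have "laplacian N a (\<lambda>i. B i k) j + (\<Sum>i=1..N. B i k) = vec_index (A *\<^sub>v col B' (k - 1)) (j - 1)"
      proof -
        have "B i k = vec_index (col B' (k - 1)) (i - 1)" if "i \<in> {1..N}" for i
          using that ik B'(1) by (auto simp: B_def)
        then have "laplacian N a (\<lambda>i. B i k) j + (\<Sum>i=1..N. B i k) = laplacian N a (\<lambda>i. vec_index (col B' (k - 1)) (i - 1)) j
          + (\<Sum>i=1..N. vec_index (col B' (k - 1)) (i - 1))"
          using j by (intro arg_cong2[where f="(+)"] laplacian_cong sum.cong) auto
        then show ?thesis
          using Av[of "col B' (k - 1)" "j - 1"] ik j B'(1) by auto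
      qed
      also have "\<dots> = (A * B') $$ (j - 1, k - 1)"
        using A B'(1) ik j by auto
      also have "\<dots> = (if j = k then 1 else 0)"
      proof -
        have "j - 1 < N" "k - 1 < N" "j - 1 = k - 1 \<longleftrightarrow> j = k"
          using ik j by auto
        then show ?thesis unfolding B'(2) by simp
      qed
      finally show ?thesis .
    qed
    have "(\<Sum>j=1..N. if j = k then 1 else 0 :: real) = 1"
      using ik by simp
    then show ?thesis
      using sum0[OF *, of 1] *[OF ik(1)] by simp
  qed
  show ?thesis
  proof
    fix w :: "nat \<Rightarrow> 'a" and i
    assume w: "(\<Sum>k=1..N. w k) = 0" and i: "i \<in> {1..N}"
    have "laplacian N a (\<lambda>i. \<Sum>k=1..N. B i k *\<^sub>R w k) i = (\<Sum>j=1..N. \<Sum>k=1..N. (a i j * (B i k - B j k)) *\<^sub>R w k)"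
      unfolding laplacian_def sum_subtractf[symmetric] by (simp add: scaleR_sum_right algebra_simps)
    also have "\<dots> = (\<Sum>k=1..N. laplacian N a (\<lambda>i. B i k) i *\<^sub>R w k)"
      by (subst sum.swap) (simp add: laplacian_def scaleR_sum_left)
    also have "\<dots> = (\<Sum>k=1..N. (if i = k then w k else 0) - (1 / N) *\<^sub>R w k)"
      using B i by (intro sum.cong) (auto simp: scaleR_diff_left)
    also have "\<dots> = w i - (1 / N) *\<^sub>R (\<Sum>k=1..N. w k)"
      using i by (simp add: sum_subtractf scaleR_sum_right)
    finally show "laplacian N a (\<lambda>i. \<Sum>k=1..N. B i k *\<^sub>R w k) i = w i"
      using w by simp
  qed
qed (use that in simp)

end

section \<open>Decay of the energy\<close>

lemma has_real_derivative_inner: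
  fixes u v :: "real \<Rightarrow> 'a::real_inner"
  assumes "(u has_vector_derivative u') (at t within S)" "(v has_vector_derivative v') (at t within S)"
  shows "((\<lambda>t. u t \<bullet> v t) has_real_derivative (u t \<bullet> v' + u' \<bullet> v t)) (at t within S)"
  using bounded_bilinear.has_vector_derivative[OF bounded_bilinear_inner assms]
  by (simp add: has_real_derivative_iff_has_vector_derivative)

text \<open>The one-sided derivative at \<open>0\<close> enters only through continuity; the sign is
  used at interior points, where the derivative is two-sided.\<close>

lemma nonincreasing_from_zero:
  fixes f :: "real \<Rightarrow> real"
  assumes der: "\<And>t. t \<ge> 0 \<Longrightarrow> (f has_real_derivative f' t) (at t within {0..})"
    and neg: "\<And>t. t \<ge> 0 \<Longrightarrow> f' t \<le> 0" and "t \<ge> 0"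
  shows "f t \<le> f 0"
  using \<open>t \<ge> 0\<close>
proof (rule DERIV_nonpos_imp_decreasing_open)
  fix x assume "0 < x" "x < t"
  then have "at x within {0..} = at x"
    by (intro at_within_interior) auto
  then show "\<exists>y. (f has_real_derivative y) (at x) \<and> y \<le> 0"
    using der[of x] neg[of x] \<open>0 < x\<close> by auto
next
  have "continuous_on {0..} f"
    by (rule DERIV_continuous_on[OF der]) auto
  then show "continuous_on {0..t} f"
    by (rule continuous_on_subset) auto
qed

text \<open>The integrating factor \<open>exp (r * t)\<close> turns the differential inequality into
  monotonicity.\<close>

lemma exponential_decay_from_zero:
  fixes f :: "real \<Rightarrow> real"
  assumes der: "\<And>t. t \<ge> 0 \<Longrightarrow> (f has_real_derivative f' t) (at t within {0..})"
    and neg: "\<And>t. t \<ge> 0 \<Longrightarrow> f' t \<le> - r * f t" and "t \<ge> 0"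
  shows "f t \<le> f 0 * exp (- r * t)"
proof -
  have "f t * exp (r * t) \<le> f 0 * exp (r * 0)"
  proof (rule nonincreasing_from_zero[OF _ _ \<open>t \<ge> 0\<close>])
    show "((\<lambda>t. f t * exp (r * t)) has_real_derivative (f' t + r * f t) * exp (r * t)) (at t within {0..})"
      if "t \<ge> 0" for t
      using der[OF that] by (auto intro!: derivative_eq_intros simp: algebra_simps)
    show "(f' t + r * f t) * exp (r * t) \<le> 0" if "t \<ge> 0" for t
      using neg[OF that] by (simp add: mult_le_0_iff)
  qed
  then show ?thesis
    by (simp add: exp_minus field_simps)
qed

section \<open>The energy of the error dynamics\<close>

text \<open>The nonlinearity enters only as a family \<open>p\<close>. This covers both the
  truncated system relative to its equilibrium and the difference of two solutions of the original
  system.\<close>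

locale error_system = connected_network N a for N a +
  fixes \<alpha> \<beta> :: real and B :: "nat \<Rightarrow> nat \<Rightarrow> real" and y w p :: "nat \<Rightarrow> real \<Rightarrow> 'a::real_inner"
  assumes \<alpha>: "\<alpha> > 0" and \<beta>: "\<beta> > 0"
    and B: "\<And>(w :: nat \<Rightarrow> 'a) i. \<lbrakk>(\<Sum>k=1..N. w k) = 0; i \<in> {1..N}\<rbrakk> \<Longrightarrow>
       laplacian N a (\<lambda>i. \<Sum>k=1..N. B i k *\<^sub>R w k) i = w i"
    and dw: "\<And>i t. \<lbrakk>i \<in> {1..N}; t \<ge> 0\<rbrakk> \<Longrightarrow>
       (w i has_vector_derivative (\<alpha> * \<beta>) *\<^sub>R laplacian N a (\<lambda>j. y j t) i) (at t within {0..})"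
    and dy: "\<And>i t. \<lbrakk>i \<in> {1..N}; t \<ge> 0\<rbrakk> \<Longrightarrow>
       (y i has_vector_derivative
          - \<alpha> *\<^sub>R p i t - \<beta> *\<^sub>R laplacian N a (\<lambda>j. y j t) i - w i t) (at t within {0..})"
    and w0: "(\<Sum>i=1..N. w i 0) = 0"
begin

text \<open>A preimage of \<open>w\<close> under the Laplacian, by \<open>laplacian_pot\<close>.
  Hence the second part of the energy is a Laplacian form, and so nonnegative.\<close>

definition pot :: "real \<Rightarrow> nat \<Rightarrow> 'a" where
  "pot t i = (\<Sum>k=1..N. B i k *\<^sub>R w k t)"

definition energy :: "real \<Rightarrow> real" where
  "energy t = (\<Sum>i=1..N. (norm (y i t))\<^sup>2) / 2 + (\<Sum>i=1..N. pot t i \<bullet> w i t) / (2 * \<alpha> * \<beta>)"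

text \<open>The sum is conserved because Laplacians have zero sum; this keeps \<open>w\<close> where
  \<open>B\<close> inverts the Laplacian.\<close>

lemma sum_w: "t \<ge> 0 \<Longrightarrow> (\<Sum>i=1..N. w i t) = 0"
proof -
  assume t: "t \<ge> 0"
  have "((\<lambda>t. \<Sum>i=1..N. w i t) has_vector_derivative 0) (at t within {0..})" if "t \<ge> 0" for t
  proof -
    have "((\<lambda>t. \<Sum>i=1..N. w i t) has_vector_derivative
        (\<Sum>i=1..N. (\<alpha> * \<beta>) *\<^sub>R laplacian N a (\<lambda>j. y j t) i)) (at t within {0..})"
      by (rule has_vector_derivative_sum) (use dw that in auto)
    then show ?thesis
      using sum_laplacian[of "\<lambda>j. y j t"] by (simp flip: scaleR_sum_right)
  qed
  then obtain c where "\<And>s. s \<in> {0..} \<Longrightarrow> (\<Sum>i=1..N. w i s) = c"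
    using has_vector_derivative_zero_constant[of "{0..}" "\<lambda>t. \<Sum>i=1..N. w i t"] by auto
  from this[of t] this[of 0] show ?thesis using w0 t by simp
qed

lemma laplacian_pot: "i \<in> {1..N} \<Longrightarrow> t \<ge> 0 \<Longrightarrow> laplacian N a (pot t) i = w i t"
  using B[of "\<lambda>k. w k t" i] sum_w[of t] by (simp add: pot_def[abs_def])

lemma pot_inner_eq: "t \<ge> 0 \<Longrightarrow> (\<Sum>i=1..N. pot t i \<bullet> w i t) = (\<Sum>i=1..N. pot t i \<bullet> laplacian N a (pot t) i)"
  by (intro sum.cong) (auto simp: laplacian_pot)

lemma energy_ge: "t \<ge> 0 \<Longrightarrow> (\<Sum>i=1..N. (norm (y i t))\<^sup>2) / 2 \<le> energy t"
  unfolding energy_def pot_inner_eq using sum_inner_laplacian_nonneg[of "pot t"] \<alpha> \<beta> by simp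

text \<open>The potential part contributes the sum of \<open>y i t \<bullet> w i t\<close>, which
  cancels the contribution of \<open>- w\<close> in the equation for \<open>y\<close>.\<close>

lemma energy_derivative:
  assumes t: "t \<ge> 0"
  shows "(energy has_real_derivative
    - \<alpha> * (\<Sum>i=1..N. y i t \<bullet> p i t) - \<beta> * (\<Sum>i=1..N. y i t \<bullet> laplacian N a (\<lambda>j. y j t) i)) (at t within {0..})"
proof -
  define y' where "y' i = - \<alpha> *\<^sub>R p i t - \<beta> *\<^sub>R laplacian N a (\<lambda>j. y j t) i - w i t" for i
  define l where "l = laplacian N a (\<lambda>j. y j t)"
  define q' where "q' i = (\<Sum>k=1..N. B i k *\<^sub>R l k)" for i
  have dq: "((\<lambda>t. pot t i) has_vector_derivative (\<alpha> * \<beta>) *\<^sub>R q' i) (at t within {0..})" for i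
  proof -
    have "((\<lambda>t. pot t i) has_vector_derivative (\<Sum>k=1..N. B i k *\<^sub>R ((\<alpha> * \<beta>) *\<^sub>R l k))) (at t within {0..})"
      unfolding pot_def l_def
      by (intro has_vector_derivative_sum
          bounded_linear.has_vector_derivative[OF bounded_linear_scaleR_right] dw t) auto
    then show ?thesis by (simp add: q'_def scaleR_sum_right mult_ac)
  qed
  have "(energy has_real_derivative (\<Sum>i=1..N. y i t \<bullet> y' i + y' i \<bullet> y i t) / 2 +
      (\<Sum>i=1..N. pot t i \<bullet> ((\<alpha> * \<beta>) *\<^sub>R l i) + ((\<alpha> * \<beta>) *\<^sub>R q' i) \<bullet> w i t) / (2 * \<alpha> * \<beta>)) (at t within {0..})"
    unfolding energy_def power2_norm_eq_inner
    by (intro DERIV_add DERIV_cdivide DERIV_sum has_real_derivative_inner dq)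
       (use dy dw t in \<open>auto simp: y'_def l_def\<close>)
  moreover have "(\<Sum>i=1..N. pot t i \<bullet> ((\<alpha> * \<beta>) *\<^sub>R l i) + ((\<alpha> * \<beta>) *\<^sub>R q' i) \<bullet> w i t)
      = 2 * \<alpha> * \<beta> * (\<Sum>i=1..N. y i t \<bullet> w i t)"
  proof -
    \<comment> \<open>Symmetry of \<open>B\<close> is not assumed. Both halves of the product rule
      are identified by moving the Laplacian across the inner product, using that it maps
      \<open>pot t\<close> to \<open>w\<close> and \<open>q'\<close> to \<open>l\<close>.\<close>
    have 1: "(\<Sum>i=1..N. pot t i \<bullet> l i) = (\<Sum>i=1..N. y i t \<bullet> w i t)"
      unfolding l_def sum_inner_laplacian_commute using t by (intro sum.cong) (auto simp: laplacian_pot inner_commute)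
    have "(\<Sum>i=1..N. q' i \<bullet> w i t) = (\<Sum>i=1..N. q' i \<bullet> laplacian N a (pot t) i)"
      using t by (simp add: laplacian_pot)
    also have "\<dots> = (\<Sum>i=1..N. laplacian N a q' i \<bullet> pot t i)"
      by (rule sum_inner_laplacian_commute)
    also have "\<dots> = (\<Sum>i=1..N. pot t i \<bullet> l i)"
      using B[of l] sum_laplacian[of "\<lambda>j. y j t"] unfolding q'_def[abs_def] l_def
      by (intro sum.cong) (auto simp: inner_commute)
    finally have 2: "(\<Sum>i=1..N. q' i \<bullet> w i t) = (\<Sum>i=1..N. pot t i \<bullet> l i)" .
    show ?thesis
      using 1 2 by (simp add: sum.distrib flip: sum_distrib_left)
  qed
  moreover have "(\<Sum>i=1..N. y i t \<bullet> y' i + y' i \<bullet> y i t) = 2 * (- \<alpha> * (\<Sum>i=1..N. y i t \<bullet> p i t)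
      - \<beta> * (\<Sum>i=1..N. y i t \<bullet> l i) - (\<Sum>i=1..N. y i t \<bullet> w i t))"
    unfolding y'_def l_def
    by (simp add: inner_commute[of "_ - _"] inner_diff_right sum.distrib sum_subtractf sum_negf flip: sum_distrib_left)
  ultimately show ?thesis
    using \<alpha> \<beta> by (simp add: l_def diff_divide_distrib)
qed

lemma energy_antimono:
  assumes "\<And>t. t \<ge> 0 \<Longrightarrow> (\<Sum>i=1..N. y i t \<bullet> p i t) \<ge> 0" and "t \<ge> 0"
  shows "energy t \<le> energy 0"
proof (rule nonincreasing_from_zero[OF energy_derivative _ \<open>t \<ge> 0\<close>])
  show "- \<alpha> * (\<Sum>i=1..N. y i t \<bullet> p i t) - \<beta> * (\<Sum>i=1..N. y i t \<bullet> laplacian N a (\<lambda>j. y j t) i) \<le> 0"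
    if "t \<ge> 0" for t
    using assms(1)[OF that] sum_inner_laplacian_nonneg[of "\<lambda>j. y j t"] \<alpha> \<beta>
    by (smt (verit) mult_nonneg_nonneg mult_minus_left)
qed

text \<open>The bound depends on initial data only; it is what confines the truncated solution to
  the ball.\<close>

lemma norm_le_energy:
  assumes "\<And>t. t \<ge> 0 \<Longrightarrow> (\<Sum>i=1..N. y i t \<bullet> p i t) \<ge> 0" and "t \<ge> 0" "i \<in> {1..N}"
  shows "(norm (y i t))\<^sup>2 \<le> 2 * energy 0"
proof -
  have "(norm (y i t))\<^sup>2 \<le> (\<Sum>i=1..N. (norm (y i t))\<^sup>2)"
    using assms(3) by (intro member_le_sum) auto
  then show ?thesis
    using energy_ge[OF assms(2)] energy_antimono[OF assms(1,2)] by linarith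
qed

text \<open>The energy starts at \<open>0\<close> and cannot grow, so \<open>y\<close> vanishes;
  then \<open>w\<close> has zero derivative. Applied to a difference of solutions, this is
  uniqueness.\<close>

lemma zero_solution:
  assumes mono: "\<And>t. t \<ge> 0 \<Longrightarrow> (\<Sum>i=1..N. y i t \<bullet> p i t) \<ge> 0"
    and y0: "\<And>i. i \<in> {1..N} \<Longrightarrow> y i 0 = 0" and w0': "\<And>i. i \<in> {1..N} \<Longrightarrow> w i 0 = 0"
    and i: "i \<in> {1..N}" and t: "t \<ge> 0"
  shows "y i t = 0 \<and> w i t = 0"
proof
  have "energy 0 = 0"
    using y0 w0' by (simp add: energy_def)
  then have yz: "y i t = 0" if "i \<in> {1..N}" "t \<ge> 0" for i t
    using norm_le_energy[OF mono that(2,1)] by simp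
  then show "y i t = 0" using i t by blast
  have "(w i has_vector_derivative 0) (at t within {0..})" if "t \<ge> 0" for t
    using dw[OF i that] laplacian_cong[of N "\<lambda>j. y j t" "\<lambda>_. 0" i a] yz[OF _ that] i by (simp add: laplacian_const)
  then obtain c where "\<And>s. s \<in> {0..} \<Longrightarrow> w i s = c"
    using has_vector_derivative_zero_constant[of "{0..}" "w i"] by auto
  from this[of t] this[of 0] show "w i t = 0" using w0' i t by simp
qed

text \<open>The energy dissipates only in \<open>y\<close>; adding a small multiple of \<open>\<Sum>i. y i t \<bullet> w i t\<close> also
  produces dissipation in \<open>w\<close>.\<close>

lemma exponential_decay:
  assumes m: "m > 0"
    and strong: "\<And>i t. \<lbrakk>i \<in> {1..N}; t \<ge> 0\<rbrakk> \<Longrightarrow> y i t \<bullet> p i t \<ge> m * (norm (y i t))\<^sup>2"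
    and lip: "\<And>i t. \<lbrakk>i \<in> {1..N}; t \<ge> 0\<rbrakk> \<Longrightarrow> norm (p i t) \<le> K * norm (y i t)"
  obtains C r where "r > 0" "\<And>t. t \<ge> 0 \<Longrightarrow> (\<Sum>i=1..N. (norm (y i t))\<^sup>2) \<le> C * exp (- r * t)"
proof -
  obtain \<Lambda> where \<Lambda>: "\<Lambda> > 0"
    "\<And>u :: nat \<Rightarrow> 'a. (\<Sum>i=1..N. (norm (laplacian N a u i))\<^sup>2) \<le> \<Lambda> * (\<Sum>i=1..N. u i \<bullet> laplacian N a u i)"
    using sum_norm_laplacian_le by blast
  obtain C where C: "C > 0"
    "\<And>u :: nat \<Rightarrow> 'a. (\<Sum>i=1..N. u i \<bullet> laplacian N a u i) \<le> C * (\<Sum>i=1..N. (norm (laplacian N a u i))\<^sup>2)"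
    using laplacian_form_le_sum_norm by blast
  define Y where "Y t = (\<Sum>i=1..N. (norm (y i t))\<^sup>2)" for t
  define W where "W t = (\<Sum>i=1..N. (norm (w i t))\<^sup>2)" for t
  define E where "E t = (\<Sum>i=1..N. y i t \<bullet> laplacian N a (\<lambda>j. y j t) i)" for t
  define P where "P t = (\<Sum>i=1..N. y i t \<bullet> p i t)" for t
  define Q where "Q t = (\<Sum>i=1..N. pot t i \<bullet> w i t)" for t
  define S where "S t = (\<Sum>i=1..N. y i t \<bullet> w i t)" for t
  define S' where "S' t = (\<Sum>i=1..N. y i t \<bullet> ((\<alpha> * \<beta>) *\<^sub>R laplacian N a (\<lambda>j. y j t) i)
    + (- \<alpha> *\<^sub>R p i t - \<beta> *\<^sub>R laplacian N a (\<lambda>j. y j t) i - w i t) \<bullet> w i t)" for t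
  have Y0: "Y t \<ge> 0" and W0: "W t \<ge> 0" for t
    unfolding Y_def W_def by (auto intro: sum_nonneg)
  have E0: "E t \<ge> 0" for t
    unfolding E_def by (rule sum_inner_laplacian_nonneg)
  have Pge: "P t \<ge> m * Y t" if "t \<ge> 0" for t
    unfolding P_def Y_def sum_distrib_left by (intro sum_mono strong that)
  have WQ: "W t \<le> \<Lambda> * Q t" "Q t \<le> C * W t" if "t \<ge> 0" for t
  proof -
    have "W t = (\<Sum>i=1..N. (norm (laplacian N a (pot t) i))\<^sup>2)"
      unfolding W_def using laplacian_pot[OF _ that] by (intro sum.cong) auto
    then show "W t \<le> \<Lambda> * Q t" "Q t \<le> C * W t"
      using \<Lambda>(2)[of "pot t"] C(2)[of "pot t"] by (simp_all only: Q_def pot_inner_eq[OF that])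
  qed
  have dS: "(S has_real_derivative S' t) (at t within {0..})" if "t \<ge> 0" for t
    unfolding S_def S'_def by (intro DERIV_sum has_real_derivative_inner dy dw that) auto
  have S'le: "S' t \<le> (\<alpha> * \<beta> + \<beta>\<^sup>2 * \<Lambda>) * E t + \<alpha>\<^sup>2 * K\<^sup>2 * Y t - W t / 2" if t: "t \<ge> 0" for t
  proof -
    define l where "l = laplacian N a (\<lambda>j. y j t)"
    \<comment> \<open>Scaled so that the two cross terms with \<open>w\<close> cost a quarter of its
      squared norm each, leaving half of the dissipation.\<close>
    have young: "- (u \<bullet> z) \<le> (norm u)\<^sup>2 + (norm z)\<^sup>2 / 4" for u z :: 'a
    proof -
      have "0 \<le> (norm (u + z /\<^sub>R 2))\<^sup>2" by simp
      also have "\<dots> = (norm u)\<^sup>2 + (norm z)\<^sup>2 / 4 + u \<bullet> z"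
        by (simp add: power2_norm_eq_inner inner_add_left inner_add_right inner_commute)
      finally show ?thesis by simp
    qed
    have "S' t \<le> (\<Sum>i=1..N. \<alpha> * \<beta> * (y i t \<bullet> l i) + \<alpha>\<^sup>2 * K\<^sup>2 * (norm (y i t))\<^sup>2 + \<beta>\<^sup>2 * (norm (l i))\<^sup>2 - (norm (w i t))\<^sup>2 / 2)"
      unfolding S'_def l_def[symmetric]
    proof (rule sum_mono)
      fix i assume i: "i \<in> {1..N}"
      have "(norm (p i t))\<^sup>2 \<le> (K * norm (y i t))\<^sup>2"
        using lip[OF i t] by (intro power_mono) auto
      then have "(norm (\<alpha> *\<^sub>R p i t))\<^sup>2 \<le> \<alpha>\<^sup>2 * K\<^sup>2 * (norm (y i t))\<^sup>2"
        by (simp add: power_mult_distrib mult.assoc mult_left_mono)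
      moreover have "(norm (\<beta> *\<^sub>R l i))\<^sup>2 = \<beta>\<^sup>2 * (norm (l i))\<^sup>2"
        by (simp add: power_mult_distrib)
      moreover have "(- \<alpha> *\<^sub>R p i t - \<beta> *\<^sub>R l i - w i t) \<bullet> w i t
          = - ((\<alpha> *\<^sub>R p i t) \<bullet> w i t) - (\<beta> *\<^sub>R l i) \<bullet> w i t - (norm (w i t))\<^sup>2"
        by (simp add: inner_diff_left power2_norm_eq_inner)
      ultimately show "y i t \<bullet> ((\<alpha> * \<beta>) *\<^sub>R l i) + (- \<alpha> *\<^sub>R p i t - \<beta> *\<^sub>R l i - w i t) \<bullet> w i t
          \<le> \<alpha> * \<beta> * (y i t \<bullet> l i) + \<alpha>\<^sup>2 * K\<^sup>2 * (norm (y i t))\<^sup>2 + \<beta>\<^sup>2 * (norm (l i))\<^sup>2 - (norm (w i t))\<^sup>2 / 2"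
        using young[of "\<alpha> *\<^sub>R p i t" "w i t"] young[of "\<beta> *\<^sub>R l i" "w i t"] by simp
    qed
    also have "\<dots> = \<alpha> * \<beta> * E t + \<alpha>\<^sup>2 * K\<^sup>2 * Y t + \<beta>\<^sup>2 * (\<Sum>i=1..N. (norm (l i))\<^sup>2) - W t / 2"
      unfolding E_def Y_def W_def l_def
      by (simp add: sum.distrib sum_subtractf sum_distrib_left sum_divide_distrib)
    also have "\<dots> \<le> \<alpha> * \<beta> * E t + \<alpha>\<^sup>2 * K\<^sup>2 * Y t + \<beta>\<^sup>2 * (\<Lambda> * E t) - W t / 2"
      using \<Lambda>(2)[of "\<lambda>j. y j t"] by (auto simp: E_def l_def intro!: mult_left_mono)
    finally show ?thesis by (simp add: algebra_simps)
  qed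
  have Sle: "\<bar>S t\<bar> \<le> (Y t + W t) / 2" for t
  proof -
    have "\<bar>S t\<bar> \<le> (\<Sum>i=1..N. \<bar>y i t \<bullet> w i t\<bar>)"
      unfolding S_def by (rule sum_abs)
    also have "\<dots> \<le> (\<Sum>i=1..N. ((norm (y i t))\<^sup>2 + (norm (w i t))\<^sup>2) / 2)"
    proof (rule sum_mono)
      fix i
      have "\<bar>y i t \<bullet> w i t\<bar> \<le> norm (y i t) * norm (w i t)"
        by (rule Cauchy_Schwarz_ineq2)
      also have "\<dots> \<le> ((norm (y i t))\<^sup>2 + (norm (w i t))\<^sup>2) / 2"
        using sum_squares_bound[of "norm (y i t)" "norm (w i t)"] by (simp add: mult.assoc)
      finally show "\<bar>y i t \<bullet> w i t\<bar> \<le> ((norm (y i t))\<^sup>2 + (norm (w i t))\<^sup>2) / 2" .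
    qed
    finally show ?thesis
      by (simp add: Y_def W_def sum.distrib flip: sum_divide_distrib)
  qed
  define k1 where "k1 = \<alpha> * \<beta> + \<beta>\<^sup>2 * \<Lambda>"
  define k2 where "k2 = \<alpha>\<^sup>2 * K\<^sup>2 + 1"
  \<comment> \<open>The bound \<open>1/2\<close> keeps part of \<open>Y\<close> in
    \<open>lower\<close>; \<open>\<beta> / k1\<close> lets the energy dissipation absorb the
    \<open>E\<close> term of \<open>S'\<close>; \<open>\<alpha> * m / (2 * k2)\<close> spends at
    most half of the dissipation from strong convexity; the last bound lets \<open>U\<close> absorb
    the \<open>W\<close> part of the cross term.\<close>
  define \<epsilon> where "\<epsilon> = Min {1/2, \<beta> / k1, \<alpha> * m / (2 * k2), 1 / (\<alpha> * \<beta> * \<Lambda>)}"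
  have k: "k1 > 0" "k2 > 0"
    unfolding k1_def k2_def using \<alpha> \<beta> \<Lambda>(1) by (auto intro!: add_pos_pos add_nonneg_pos)
  have \<epsilon>: "\<epsilon> > 0" "\<epsilon> \<le> 1/2" "\<epsilon> \<le> \<beta> / k1" "\<epsilon> \<le> \<alpha> * m / (2 * k2)" "\<epsilon> \<le> 1 / (\<alpha> * \<beta> * \<Lambda>)"
  proof -
    show "\<epsilon> > 0"
      unfolding \<epsilon>_def using \<alpha> \<beta> \<Lambda>(1) k m by auto
  qed (unfold \<epsilon>_def, (rule Min_le; simp)+)
  have \<epsilon>': "\<epsilon> * k1 \<le> \<beta>" "\<epsilon> * k2 \<le> \<alpha> * m / 2" "\<epsilon> * \<Lambda> \<le> 1 / (\<alpha> * \<beta>)"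
    using \<epsilon>(3-5) k \<alpha> \<beta> \<Lambda>(1) by (auto simp: field_simps)
  define \<Phi> where "\<Phi> t = energy t + \<epsilon> * S t" for t
  define U where "U t = Q t / (2 * \<alpha> * \<beta>)" for t
  define c1 where "c1 = C / (2 * \<alpha> * \<beta>)"
  define c2 where "c2 = 1 + c1"
  define c3 where "c3 = min (\<alpha> * m / 2) (\<epsilon> / 2)"
  have c: "c1 > 0" "c2 > 0" "c3 > 0"
    unfolding c1_def c2_def c3_def using C(1) \<alpha> \<beta> m \<epsilon>(1) by (auto intro!: add_pos_pos)
  have energy: "energy t = Y t / 2 + U t" for t
    by (simp add: energy_def Y_def U_def Q_def)
  \<comment> \<open>All of \<open>U\<close> is spent on the cross term, and a quarter of
    \<open>Y\<close> survives. This is enough, as only \<open>y\<close> has to be estimated.\<close>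
  have lower: "Y t / 4 \<le> \<Phi> t" if t: "t \<ge> 0" for t
  proof -
    have "\<epsilon> * - S t \<le> \<epsilon> * ((Y t + W t) / 2)"
      using Sle[of t] \<epsilon>(1) by (intro mult_left_mono) auto
    moreover have "\<epsilon> * Y t \<le> 1/2 * Y t"
      using \<epsilon>(2) Y0 by (intro mult_right_mono) auto
    moreover have "\<epsilon> * W t \<le> 2 * U t"
    proof -
      have Q0: "Q t \<ge> 0"
        using WQ(1)[OF t] W0[of t] \<Lambda>(1) by (smt (verit) zero_le_mult_iff)
      have "\<epsilon> * W t \<le> \<epsilon> * (\<Lambda> * Q t)"
        using WQ(1)[OF t] \<epsilon>(1) by (intro mult_left_mono) auto
      also have "\<dots> = (\<epsilon> * \<Lambda>) * Q t" by simp
      also have "\<dots> \<le> 1 / (\<alpha> * \<beta>) * Q t"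
        using \<epsilon>'(3) Q0 by (rule mult_right_mono)
      finally show ?thesis by (simp add: U_def)
    qed
    moreover have "\<epsilon> * ((Y t + W t) / 2) = (\<epsilon> * Y t + \<epsilon> * W t) / 2" "\<epsilon> * - S t = - (\<epsilon> * S t)"
      by (simp_all add: algebra_simps)
    ultimately show ?thesis
      unfolding \<Phi>_def energy by argo
  qed
  have upper: "\<Phi> t \<le> c2 * (Y t + W t)" if t: "t \<ge> 0" for t
  proof -
    have "\<epsilon> * S t \<le> 1/2 * ((Y t + W t) / 2)"
      using Sle[of t] \<epsilon>(1,2) Y0[of t] W0[of t] by (intro order_trans[OF mult_left_mono mult_right_mono]) auto
    moreover have "U t \<le> c1 * W t"
      using divide_right_mono[OF WQ(2)[OF t], of "2 * \<alpha> * \<beta>"] \<alpha> \<beta> by (simp add: U_def c1_def)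
    moreover have "0 \<le> c1 * Y t"
      using c(1) Y0[of t] by simp
    moreover have "c2 * (Y t + W t) = Y t + W t + c1 * Y t + c1 * W t"
      by (simp add: c2_def algebra_simps)
    ultimately show ?thesis
      unfolding \<Phi>_def energy using Y0[of t] W0[of t] by argo
  qed
  have "(\<Sum>i=1..N. (norm (y i t))\<^sup>2) \<le> 4 * \<Phi> 0 * exp (- (c3 / c2) * t)" if "t \<ge> 0" for t
  proof -
    have "\<Phi> t \<le> \<Phi> 0 * exp (- (c3 / c2) * t)"
    proof (rule exponential_decay_from_zero[OF _ _ that])
      show "(\<Phi> has_real_derivative (- \<alpha> * P t - \<beta> * E t) + \<epsilon> * S' t) (at t within {0..})" if "t \<ge> 0" for t
        unfolding \<Phi>_def P_def E_def by (intro DERIV_add energy_derivative DERIV_cmult dS that)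
      show "(- \<alpha> * P t - \<beta> * E t) + \<epsilon> * S' t \<le> - (c3 / c2) * \<Phi> t" if t: "t \<ge> 0" for t
      proof -
        have "\<epsilon> * S' t \<le> \<epsilon> * (k1 * E t + k2 * Y t - W t / 2)"
          using S'le[OF t] Y0[of t] \<epsilon>(1) by (intro mult_left_mono) (auto simp: k1_def k2_def algebra_simps)
        also have "\<dots> = (\<epsilon> * k1) * E t + (\<epsilon> * k2) * Y t - \<epsilon> / 2 * W t"
          by (simp add: algebra_simps)
        also have "\<dots> \<le> \<beta> * E t + (\<alpha> * m / 2) * Y t - \<epsilon> / 2 * W t"
          using \<epsilon>' E0[of t] Y0[of t] by (intro diff_right_mono add_mono mult_right_mono) auto
        finally have "(- \<alpha> * P t - \<beta> * E t) + \<epsilon> * S' t \<le> - \<alpha> * P t + (\<alpha> * m / 2) * Y t - \<epsilon> / 2 * W t"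
          by simp
        also have "\<dots> \<le> - ((\<alpha> * m / 2) * Y t) - \<epsilon> / 2 * W t"
          using mult_left_mono[OF Pge[OF t], of \<alpha>] \<alpha> by simp
        also have "\<dots> \<le> - (c3 * Y t) - c3 * W t"
          using Y0[of t] W0[of t] by (intro diff_mono le_imp_neg_le mult_right_mono) (auto simp: c3_def)
        also have "\<dots> = - (c3 / c2) * (c2 * (Y t + W t))"
          using c by (simp add: algebra_simps)
        also have "\<dots> \<le> - (c3 / c2) * \<Phi> t"
          using upper[OF t] c by (intro mult_left_mono_neg) auto
        finally show ?thesis .
      qed
    qed
    then show ?thesis
      using lower[OF that] by (simp add: Y_def)
  qed
  moreover have "c3 / c2 > 0" using c by simp
  ultimately show ?thesis using that by blast
qed

end

section \<open>Gradients and projections onto balls\<close>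

text \<open>The definite description in \<open>gradient\<close> is justified here: the adjoint of
  the derivative at \<open>1\<close> represents it, and the representing vector is unique.\<close>

lemma gderiv_gradient:
  fixes f :: "'a::euclidean_space \<Rightarrow> real"
  assumes "f differentiable (at x)"
  shows "GDERIV f x :> gradient f x"
proof -
  obtain f' where f': "(f has_derivative f') (at x)"
    using assms by (auto simp: differentiable_def)
  have "linear f'"
    using f' by (rule has_derivative_linear)
  then have "f' = (\<lambda>h. h \<bullet> adjoint f' 1)"
    by (simp add: adjoint_works)
  with f' have D: "GDERIV f x :> adjoint f' 1"
    by (simp add: gderiv_def)
  have "D = adjoint f' 1" if "GDERIV f x :> D" for D
  proof -
    have "(\<lambda>h. h \<bullet> D) = (\<lambda>h. h \<bullet> adjoint f' 1)"
      using that D unfolding gderiv_def by (rule has_derivative_unique)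
    then have "(D - adjoint f' 1) \<bullet> (D - adjoint f' 1) = 0"
      by (metis inner_diff_right diff_self)
    then show ?thesis by simp
  qed
  with D show ?thesis
    unfolding gradient_def by (rule theI)
qed

text \<open>Fermat's rule. The single gradients at the minimizer may be nonzero; only their sum
  vanishes, which is what the zero-sum condition on the shifted \<open>v\<close> requires.\<close>

lemma sum_gradient_arg_min:
  fixes f :: "'i \<Rightarrow> 'a::euclidean_space \<Rightarrow> real"
  assumes "\<And>i. i \<in> I \<Longrightarrow> f i differentiable (at x)"
    and "is_arg_min (\<lambda>z. \<Sum>i\<in>I. f i z) (\<lambda>_. True) x"
  shows "(\<Sum>i\<in>I. gradient (f i) x) = 0"
proof -
  let ?G = "\<Sum>i\<in>I. gradient (f i) x"
  have "((\<lambda>z. \<Sum>i\<in>I. f i z) has_derivative (\<lambda>h. \<Sum>i\<in>I. h \<bullet> gradient (f i) x)) (at x)"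
    using gderiv_gradient assms(1) by (intro has_derivative_sum) (auto simp: gderiv_def)
  then have "(\<lambda>h. \<Sum>i\<in>I. h \<bullet> gradient (f i) x) = (\<lambda>h. 0)"
    by (rule differential_zero_maxmin[of x UNIV, rotated 2])
       (use assms(2) in \<open>auto simp: is_arg_min_def not_less\<close>)
  then have "?G \<bullet> ?G = 0"
    by (metis inner_sum_right)
  then show ?thesis by simp
qed

text \<open>The projection moves a point along the ray from the centre. The positive factor
  transfers the sign of an inner product from the projected displacement to the original
  one.\<close>

lemma closest_point_cball:
  fixes c x :: "'a::euclidean_space"
  assumes "R > 0"
  obtains \<theta> where "0 < \<theta>" "closest_point (cball c R) x = c + \<theta> *\<^sub>R (x - c)"
proof (cases "x \<in> cball c R")
  case True
  then have "closest_point (cball c R) x = c + 1 *\<^sub>R (x - c)"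
    by (simp add: closest_point_self)
  then show ?thesis using that[of 1] by simp
next
  case False
  define d where "d = norm (x - c)"
  have d: "d > R" using False by (simp add: d_def dist_norm norm_minus_commute)
  have "c + (R / d) *\<^sub>R (x - c) = closest_point (cball c R) x"
  proof (rule closest_point_unique)
    show "c + (R / d) *\<^sub>R (x - c) \<in> cball c R"
      using assms d by (simp add: dist_norm d_def)
    have "x - (c + (R / d) *\<^sub>R (x - c)) = (1 - R / d) *\<^sub>R (x - c)"
      by (simp add: algebra_simps)
    then have "dist x (c + (R / d) *\<^sub>R (x - c)) = \<bar>1 - R / d\<bar> * d"
      by (simp only: dist_norm norm_scaleR d_def)
    also have "\<dots> = d - R"
      using d assms by (simp add: left_diff_distrib)
    finally have "dist x (c + (R / d) *\<^sub>R (x - c)) = d - R" .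
    moreover have "d - R \<le> dist x z" if "z \<in> cball c R" for z
      using that dist_triangle[of x c z] by (simp add: d_def dist_norm norm_minus_commute)
    ultimately show "\<forall>z\<in>cball c R. dist x (c + (R / d) *\<^sub>R (x - c)) \<le> dist x z" by simp
  qed (use assms in auto)
  then show ?thesis using that[of "R / d"] assms d by simp
qed

lemma locally_lipschitz_cball:
  fixes g :: "'a::heine_borel \<Rightarrow> 'b::metric_space"
  assumes "locally_lipschitz g"
  obtains L where "L-lipschitz_on (cball c R) g"
proof -
  \<comment> \<open>The time set is shrunk to one point so that both sets are compact.\<close>
  have "local_lipschitz {0::real} (cball c R) (\<lambda>_. g)"
    using assms unfolding locally_lipschitz_def by (rule local_lipschitz_subset) auto
  from local_lipschitz_compact_implies_lipschitz[OF this compact_cball compact_sing]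
  show ?thesis using that by auto
qed

section \<open>The network flow\<close>

lemma network_solution_iff:
  "network_solution N a \<alpha> \<beta> f x v \<longleftrightarrow>
     (\<forall>i\<in>{1..N}. \<forall>t\<ge>0.
        (v i has_vector_derivative (\<alpha> * \<beta>) *\<^sub>R laplacian N a (\<lambda>j. x j t) i) (at t within {0..}) \<and>
        (x i has_vector_derivative
           - \<alpha> *\<^sub>R gradient (f i) (x i t) - \<beta> *\<^sub>R laplacian N a (\<lambda>j. x j t) i - v i t) (at t within {0..}))"
  by (simp add: network_solution_def laplacian_def)

lemma norm_laplacian_le:
  fixes u :: "nat \<Rightarrow> 'a::real_normed_vector"
  assumes "i \<in> {1..N}"
  shows "norm (laplacian N a u i) \<le> 2 * (\<Sum>j=1..N. \<bar>a i j\<bar>) * (\<Sum>j=1..N. norm (u j))"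
proof -
  have le: "norm (u j) \<le> (\<Sum>j=1..N. norm (u j))" if "j \<in> {1..N}" for j
    using that by (intro member_le_sum) auto
  have "norm (laplacian N a u i) \<le> (\<Sum>j=1..N. \<bar>a i j\<bar> * (2 * (\<Sum>j=1..N. norm (u j))))"
    unfolding laplacian_def
  proof (rule sum_norm_le)
    fix j assume j: "j \<in> {1..N}"
    have "norm (u i - u j) \<le> 2 * (\<Sum>j=1..N. norm (u j))"
      using norm_triangle_ineq4[of "u i" "u j"] le[OF j] le[OF assms] by linarith
    then show "norm (a i j *\<^sub>R (u i - u j)) \<le> \<bar>a i j\<bar> * (2 * (\<Sum>j=1..N. norm (u j)))"
      by (simp add: mult_left_mono)
  qed
  then show ?thesis
    unfolding sum_distrib_right[symmetric] by (simp add: mult_ac)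
qed

text \<open>Projection onto a convex set is nonexpansive, so a map Lipschitz on the ball becomes
  globally Lipschitz after precomposition. The two states of a node are paired to form one
  family.\<close>

lemma truncated_solution:
  fixes g :: "nat \<Rightarrow> 'a::euclidean_space \<Rightarrow> 'a" and b d :: "nat \<Rightarrow> 'a"
  assumes R: "R > 0" and lip: "\<And>i. i \<in> {1..N} \<Longrightarrow> (L i)-lipschitz_on (cball c R) (g i)"
  obtains x v where
    "\<And>i. i \<in> {1..N} \<Longrightarrow> x i 0 = b i \<and> v i 0 = d i"
    "\<And>i t. \<lbrakk>i \<in> {1..N}; t \<ge> 0\<rbrakk> \<Longrightarrow>
       (v i has_vector_derivative (\<alpha> * \<beta>) *\<^sub>R laplacian N a (\<lambda>j. x j t) i) (at t within {0..})"
    "\<And>i t. \<lbrakk>i \<in> {1..N}; t \<ge> 0\<rbrakk> \<Longrightarrow>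
       (x i has_vector_derivative - \<alpha> *\<^sub>R g i (closest_point (cball c R) (x i t))
          - \<beta> *\<^sub>R laplacian N a (\<lambda>j. x j t) i - v i t) (at t within {0..})"
proof -
  let ?P = "closest_point (cball c R)"
  define F :: "nat \<Rightarrow> (nat \<Rightarrow> 'a \<times> 'a) \<Rightarrow> 'a \<times> 'a" where
    "F i s = (- \<alpha> *\<^sub>R g i (?P (fst (s i))) - \<beta> *\<^sub>R laplacian N a (\<lambda>j. fst (s j)) i - snd (s i),
       (\<alpha> * \<beta>) *\<^sub>R laplacian N a (\<lambda>j. fst (s j)) i)" for i s
  define D where "D i = 2 * (\<Sum>j=1..N. \<bar>a i j\<bar>)" for i
  \<comment> \<open>The summands bound, in order, the map \<open>g i\<close>, the coupling and the
    state \<open>v\<close> in the first component, and the coupling in the second.\<close>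
  define M where "M i = \<bar>\<alpha>\<bar> * L i + \<bar>\<beta>\<bar> * D i + 1 + \<bar>\<alpha> * \<beta>\<bar> * D i" for i
  have D0: "D i \<ge> 0" for i
    unfolding D_def by (auto intro: sum_nonneg)
  have L0: "L i \<ge> 0" if "i \<in> {1..N}" for i
    using lip[OF that] by (rule lipschitz_on_nonneg)
  have FM: "norm (F i s - F i s') \<le> M i * (\<Sum>j\<in>{1..N}. norm (s j - s' j))" (is "_ \<le> _ * ?T")
    if i: "i \<in> {1..N}" for i s s'
  proof -
    have le: "norm (s i - s' i) \<le> ?T"
      using i by (intro member_le_sum) auto
    have f1: "norm (fst (s j) - fst (s' j)) \<le> norm (s j - s' j)" for j
      by (metis fst_diff norm_fst_le prod.collapse)
    have f2: "norm (snd (s j) - snd (s' j)) \<le> norm (s j - s' j)" for j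
      by (metis snd_diff norm_snd_le prod.collapse)
    define G where "G = g i (?P (fst (s i))) - g i (?P (fst (s' i)))"
    define l where "l = laplacian N a (\<lambda>j. fst (s j)) i - laplacian N a (\<lambda>j. fst (s' j)) i"
    define z where "z = snd (s i) - snd (s' i)"
    have G: "norm G \<le> L i * ?T"
    proof -
      have "norm G \<le> L i * dist (?P (fst (s i))) (?P (fst (s' i)))"
        unfolding G_def dist_norm[symmetric] using R
        by (intro lipschitz_onD[OF lip[OF i]] closest_point_in_set) auto
      also have "dist (?P (fst (s i))) (?P (fst (s' i))) \<le> dist (fst (s i)) (fst (s' i))"
        using R by (intro closest_point_lipschitz) auto
      also have "\<dots> \<le> ?T"
        unfolding dist_norm using f1[of i] le by (rule order_trans)
      finally show ?thesis using L0[OF i] by (simp add: mult_left_mono)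
    qed
    have l: "norm l \<le> D i * ?T"
    proof -
      have "norm l \<le> D i * (\<Sum>j=1..N. norm (fst (s j) - fst (s' j)))"
        unfolding l_def D_def laplacian_diff[symmetric] using i by (rule norm_laplacian_le)
      also have "\<dots> \<le> D i * ?T"
        using D0 f1 by (intro mult_left_mono sum_mono) auto
      finally show ?thesis .
    qed
    have "F i s - F i s' = (- \<alpha> *\<^sub>R G - \<beta> *\<^sub>R l - z, (\<alpha> * \<beta>) *\<^sub>R l)"
      by (simp add: F_def G_def l_def z_def algebra_simps)
    then have "norm (F i s - F i s') \<le> norm (- \<alpha> *\<^sub>R G - \<beta> *\<^sub>R l - z) + norm ((\<alpha> * \<beta>) *\<^sub>R l)"
      by (metis norm_Pair_le)
    also have "norm (- \<alpha> *\<^sub>R G - \<beta> *\<^sub>R l - z) \<le> \<bar>\<alpha>\<bar> * norm G + \<bar>\<beta>\<bar> * norm l + norm z"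
      using norm_triangle_ineq4[of "- \<alpha> *\<^sub>R G - \<beta> *\<^sub>R l" z] norm_triangle_ineq4[of "- \<alpha> *\<^sub>R G" "\<beta> *\<^sub>R l"] by simp
    also have "\<bar>\<alpha>\<bar> * norm G + \<bar>\<beta>\<bar> * norm l + norm z + norm ((\<alpha> * \<beta>) *\<^sub>R l)
        \<le> \<bar>\<alpha>\<bar> * (L i * ?T) + \<bar>\<beta>\<bar> * (D i * ?T) + ?T + \<bar>\<alpha> * \<beta>\<bar> * (D i * ?T)"
      unfolding norm_scaleR z_def using G l f2[of i] le by (intro add_mono mult_left_mono) auto
    finally show ?thesis by (simp add: M_def algebra_simps)
  qed
  have "\<exists>s. \<forall>i\<in>{1..N}. s i 0 = (b i, d i) \<and>
      (\<forall>t\<ge>0. (s i has_vector_derivative F i (\<lambda>j. s j t)) (at t within {0..}))"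
    by (rule lipschitz_global_solution_family[OF _ FM]) (use L0 D0 in \<open>auto simp: M_def\<close>)
  then obtain s where s0: "\<And>i. i \<in> {1..N} \<Longrightarrow> s i 0 = (b i, d i)" and
    s: "\<And>i t. \<lbrakk>i \<in> {1..N}; t \<ge> 0\<rbrakk> \<Longrightarrow> (s i has_vector_derivative F i (\<lambda>j. s j t)) (at t within {0..})"
    by blast
  show ?thesis
  proof
    show "fst (s i 0) = b i \<and> snd (s i 0) = d i" if "i \<in> {1..N}" for i
      using s0[OF that] by simp
    fix i t assume it: "i \<in> {1..N}" "(t::real) \<ge> 0"
    show "((\<lambda>t. snd (s i t)) has_vector_derivative (\<alpha> * \<beta>) *\<^sub>R laplacian N a (\<lambda>j. fst (s j t)) i) (at t within {0..})"
      using bounded_linear.has_vector_derivative[OF bounded_linear_snd s[OF it]] by (simp add: F_def)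
    show "((\<lambda>t. fst (s i t)) has_vector_derivative - \<alpha> *\<^sub>R g i (?P (fst (s i t)))
        - \<beta> *\<^sub>R laplacian N a (\<lambda>j. fst (s j t)) i - snd (s i t)) (at t within {0..})"
      using bounded_linear.has_vector_derivative[OF bounded_linear_fst s[OF it]] by (simp add: F_def)
  qed
qed

text \<open>To speak of "the solution" presupposes a unique global one, so existence and uniqueness
  on the half-line are part of the conclusion.\<close>

theorem theorem6:
  fixes N :: nat
    and a :: "nat \<Rightarrow> nat \<Rightarrow> real"
    and f :: "nat \<Rightarrow> real ^ 'd \<Rightarrow> real"
    and m :: "nat \<Rightarrow> real"
    and xstar :: "real ^ 'd"
    and \<alpha> \<beta> :: real
    and x0 v0 :: "nat \<Rightarrow> real ^ 'd"
  assumes "2 \<le> N"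
    and "connected_graph N a"
    and "\<And>i. i \<in> {1..N} \<Longrightarrow> m i > 0"
    and "\<And>i. i \<in> {1..N} \<Longrightarrow> f i differentiable_on UNIV"
    and "\<And>i. i \<in> {1..N} \<Longrightarrow> strongly_convex (m i) (f i)"
    and "\<And>i. i \<in> {1..N} \<Longrightarrow> locally_lipschitz (gradient (f i))"
    and "is_arg_min (\<lambda>z. \<Sum>i=1..N. f i z) (\<lambda>_. True) xstar"
    and "\<alpha> > 0" and "\<beta> > 0"
    and "(\<Sum>i=1..N. v0 i) = 0"
  shows "\<exists>x v. network_solution N a \<alpha> \<beta> f x v \<and>
           (\<forall>i\<in>{1..N}. x i 0 = x0 i \<and> v i 0 = v0 i) \<and>
           (\<forall>y w. network_solution N a \<alpha> \<beta> f y w \<and>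
                  (\<forall>i\<in>{1..N}. y i 0 = x0 i \<and> w i 0 = v0 i) \<longrightarrow>
                  (\<forall>i\<in>{1..N}. \<forall>t\<ge>0. y i t = x i t \<and> w i t = v i t)) \<and>
           (\<forall>i\<in>{1..N}. converges_exponentially (x i) xstar)"
proof -
  interpret connected_network N a by standard fact
  obtain B :: "nat \<Rightarrow> nat \<Rightarrow> real" where
    B: "\<And>(w :: nat \<Rightarrow> real ^ 'd) i. \<lbrakk>(\<Sum>k=1..N. w k) = 0; i \<in> {1..N}\<rbrakk> \<Longrightarrow>
       laplacian N a (\<lambda>i. \<Sum>k=1..N. B i k *\<^sub>R w k) i = w i"
    using laplacian_right_inverse[where 'a="real ^ 'd"] by blast
  define g where "g i = gradient (f i)" for i
  have g_strong: "m i * (norm (z - x))\<^sup>2 \<le> (z - x) \<bullet> (g i z - g i x)" if "i \<in> {1..N}" for i x z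
    using assms(5)[OF that] by (simp add: strongly_convex_def g_def)
  have g_mono: "0 \<le> (z - x) \<bullet> (g i z - g i x)" if "i \<in> {1..N}" for i x z
    using g_strong[OF that, of z x] assms(3)[OF that] by (smt (verit) zero_le_mult_iff zero_le_power2)
  have g_sum: "(\<Sum>i=1..N. g i xstar) = 0"
    unfolding g_def
    by (rule sum_gradient_arg_min) (use assms(4,7) in \<open>auto simp: differentiable_on_def\<close>)
  \<comment> \<open>The equilibrium value of \<open>v\<close>: at consensus in \<open>xstar\<close>
    the coupling vanishes, and \<open>v\<close> must balance the gradient.\<close>
  define vs where "vs i = - \<alpha> *\<^sub>R g i xstar" for i
  \<comment> \<open>The initial energy in terms of the data alone, since the radius has to be fixed
    before a solution exists. The \<open>+ 1\<close> in the radius ensures \<open>R \<ge> 1\<close>,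
    hence \<open>R \<le> R\<^sup>2\<close>.\<close>
  define e0 where "e0 = (\<Sum>i=1..N. (norm (x0 i - xstar))\<^sup>2) / 2
    + (\<Sum>i=1..N. (\<Sum>k=1..N. B i k *\<^sub>R (v0 k - vs k)) \<bullet> (v0 i - vs i)) / (2 * \<alpha> * \<beta>)"
  define R where "R = \<bar>2 * e0\<bar> + 1"
  have R: "R > 0" "2 * e0 \<le> R\<^sup>2"
    using self_le_power[of R 2] by (auto simp: R_def)
  let ?P = "closest_point (cball xstar R)"
  have "\<forall>i\<in>{1..N}. \<exists>L. L-lipschitz_on (cball xstar R) (g i)"
    unfolding g_def using assms(6) locally_lipschitz_cball by metis
  then obtain L where L: "\<And>i. i \<in> {1..N} \<Longrightarrow> (L i)-lipschitz_on (cball xstar R) (g i)"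
    by metis
  obtain x v where init: "\<And>i. i \<in> {1..N} \<Longrightarrow> x i 0 = x0 i \<and> v i 0 = v0 i"
    and dv: "\<And>i t. \<lbrakk>i \<in> {1..N}; t \<ge> 0\<rbrakk> \<Longrightarrow>
       (v i has_vector_derivative (\<alpha> * \<beta>) *\<^sub>R laplacian N a (\<lambda>j. x j t) i) (at t within {0..})"
    and dx: "\<And>i t. \<lbrakk>i \<in> {1..N}; t \<ge> 0\<rbrakk> \<Longrightarrow>
       (x i has_vector_derivative - \<alpha> *\<^sub>R g i (?P (x i t))
          - \<beta> *\<^sub>R laplacian N a (\<lambda>j. x j t) i - v i t) (at t within {0..})"
    using truncated_solution[where g=g and N=N and a=a and \<alpha>=\<alpha> and \<beta>=\<beta> and b=x0 and d=v0, OF R(1) L]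
    by blast
  define p where "p i t = g i (?P (x i t)) - g i xstar" for i t
  have laplacian_y: "laplacian N a (\<lambda>j. x j t - xstar) i = laplacian N a (\<lambda>j. x j t) i" for t i
    by (simp add: laplacian_diff laplacian_const)
  interpret E: error_system N a \<alpha> \<beta> B "\<lambda>i t. x i t - xstar" "\<lambda>i t. v i t - vs i" p
  proof
    show "((\<lambda>t. v i t - vs i) has_vector_derivative
        (\<alpha> * \<beta>) *\<^sub>R laplacian N a (\<lambda>j. x j t - xstar) i) (at t within {0..})"
      if "i \<in> {1..N}" "t \<ge> 0" for i t
      using dv[OF that] unfolding laplacian_y by (auto intro!: derivative_eq_intros)
    show "((\<lambda>t. x i t - xstar) has_vector_derivative
        - \<alpha> *\<^sub>R p i t - \<beta> *\<^sub>R laplacian N a (\<lambda>j. x j t - xstar) i - (v i t - vs i)) (at t within {0..})"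
      if "i \<in> {1..N}" "t \<ge> 0" for i t
      using dx[OF that] unfolding laplacian_y
      by (auto intro!: derivative_eq_intros simp: p_def vs_def algebra_simps)
    have "(\<Sum>i=1..N. v i 0 - vs i) = (\<Sum>i=1..N. v0 i + \<alpha> *\<^sub>R g i xstar)"
      using init by (intro sum.cong) (auto simp: vs_def)
    also have "\<dots> = (\<Sum>i=1..N. v0 i) + \<alpha> *\<^sub>R (\<Sum>i=1..N. g i xstar)"
      by (simp add: sum.distrib scaleR_sum_right)
    finally show "(\<Sum>i=1..N. v i 0 - vs i) = 0"
      using g_sum assms(10) by simp
  qed (use assms B in auto)
  have mono: "0 \<le> (\<Sum>i=1..N. (x i t - xstar) \<bullet> p i t)" for t
  proof (rule sum_nonneg)
    fix i assume i: "i \<in> {1..N}"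
    obtain \<theta> where "\<theta> > 0" "?P (x i t) = xstar + \<theta> *\<^sub>R (x i t - xstar)"
      using closest_point_cball[OF R(1)] by blast
    then show "0 \<le> (x i t - xstar) \<bullet> p i t"
      using g_mono[OF i, of "?P (x i t)" xstar] by (simp add: p_def zero_le_mult_iff)
  qed
  \<comment> \<open>The energy bound holds for the truncated solution at all times, so the
    projection never acts and no continuation argument is involved.\<close>
  have ball: "x i t \<in> cball xstar R" if "i \<in> {1..N}" "t \<ge> 0" for i t
  proof -
    have "E.energy 0 = e0"
      using init by (simp add: E.energy_def E.pot_def e0_def)
    then have "(norm (x i t - xstar))\<^sup>2 \<le> R\<^sup>2"
      using E.norm_le_energy[OF mono that(2,1)] R(2) by simp
    then have "norm (x i t - xstar) \<le> R"
      by (rule power2_le_imp_le) (use R(1) in simp)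
    then show ?thesis
      by (simp add: dist_norm norm_minus_commute)
  qed
  have sol: "network_solution N a \<alpha> \<beta> f x v"
    unfolding network_solution_iff using dv dx ball by (auto simp: closest_point_self g_def)
  have uniq: "y i t = x i t \<and> w i t = v i t"
    if yw: "network_solution N a \<alpha> \<beta> f y w" "\<forall>i\<in>{1..N}. y i 0 = x0 i \<and> w i 0 = v0 i"
      and it: "i \<in> {1..N}" "t \<ge> 0" for y w i t
  proof -
    \<comment> \<open>The gradients are untruncated here, so the competing solution may lie
      anywhere; global monotonicity suffices.\<close>
    interpret D: error_system N a \<alpha> \<beta> B "\<lambda>i t. y i t - x i t" "\<lambda>i t. w i t - v i t"
      "\<lambda>i t. g i (y i t) - g i (x i t)"
    proof
      show "((\<lambda>t. w i t - v i t) has_vector_derivative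
          (\<alpha> * \<beta>) *\<^sub>R laplacian N a (\<lambda>j. y j t - x j t) i) (at t within {0..})"
        if "i \<in> {1..N}" "t \<ge> 0" for i t
        using sol yw(1) that unfolding network_solution_iff
        by (auto intro!: derivative_eq_intros simp: laplacian_diff algebra_simps)
      show "((\<lambda>t. y i t - x i t) has_vector_derivative
          - \<alpha> *\<^sub>R (g i (y i t) - g i (x i t)) - \<beta> *\<^sub>R laplacian N a (\<lambda>j. y j t - x j t) i - (w i t - v i t))
          (at t within {0..})"
        if "i \<in> {1..N}" "t \<ge> 0" for i t
        using sol yw(1) that unfolding network_solution_iff g_def[symmetric]
        by (auto intro!: derivative_eq_intros simp: laplacian_diff algebra_simps)
      show "(\<Sum>i=1..N. w i 0 - v i 0) = 0"
        using init yw(2) by simp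
    qed (use assms B in auto)
    have "0 \<le> (\<Sum>i=1..N. (y i t - x i t) \<bullet> (g i (y i t) - g i (x i t)))" for t
      by (intro sum_nonneg g_mono)
    from D.zero_solution[OF this _ _ it] show ?thesis
      using init yw(2) by simp
  qed
  \<comment> \<open>Constants uniform over the nodes; \<open>2 \<le> N\<close> makes the index set
    nonempty.\<close>
  define m0 where "m0 = Min (m ` {1..N})"
  define K where "K = Max (L ` {1..N})"
  have m0: "m0 > 0" "\<And>i. i \<in> {1..N} \<Longrightarrow> m0 \<le> m i"
    unfolding m0_def using assms(1,3) by auto
  have "\<exists>C r. r > 0 \<and> (\<forall>t\<ge>0. (\<Sum>i=1..N. (norm (x i t - xstar))\<^sup>2) \<le> C * exp (- r * t))"
  proof -
    have "m0 * (norm (x i t - xstar))\<^sup>2 \<le> (x i t - xstar) \<bullet> p i t" if "i \<in> {1..N}" "t \<ge> 0" for i t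
    proof -
      have "m0 * (norm (x i t - xstar))\<^sup>2 \<le> m i * (norm (x i t - xstar))\<^sup>2"
        using m0(2)[OF that(1)] by (intro mult_right_mono) auto
      also have "\<dots> \<le> (x i t - xstar) \<bullet> p i t"
        using g_strong[OF that(1), of "x i t" xstar] ball[OF that] by (simp add: p_def closest_point_self)
      finally show ?thesis .
    qed
    moreover have "norm (p i t) \<le> K * norm (x i t - xstar)" if "i \<in> {1..N}" "t \<ge> 0" for i t
    proof -
      have "norm (p i t) \<le> L i * norm (x i t - xstar)"
        using lipschitz_onD[OF L[OF that(1)], of "x i t" xstar] ball[OF that] R(1)
        by (simp add: p_def closest_point_self dist_norm)
      also have "\<dots> \<le> K * norm (x i t - xstar)"
        unfolding K_def using that by (intro mult_right_mono Max_ge) auto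
      finally show ?thesis .
    qed
    ultimately show ?thesis
      using E.exponential_decay[OF m0(1)] by metis
  qed
  then obtain C r where r: "r > 0" and
    C: "\<And>t. t \<ge> 0 \<Longrightarrow> (\<Sum>i=1..N. (norm (x i t - xstar))\<^sup>2) \<le> C * exp (- r * t)"
    by blast
  have "converges_exponentially (x i) xstar" if i: "i \<in> {1..N}" for i
  proof -
    \<comment> \<open>Taking the square root halves the rate; the sign of \<open>C\<close> is not
      given, hence the absolute value.\<close>
    have "norm (x i t - xstar) \<le> sqrt \<bar>C\<bar> * exp (- (r / 2) * t)" if t: "t \<ge> 0" for t
    proof -
      have "(norm (x i t - xstar))\<^sup>2 \<le> (\<Sum>i=1..N. (norm (x i t - xstar))\<^sup>2)"
        using i by (intro member_le_sum) auto
      also have "\<dots> \<le> \<bar>C\<bar> * exp (- r * t)"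
        using C[OF t] by (rule order_trans) (auto intro: mult_right_mono)
      also have "\<dots> = (sqrt \<bar>C\<bar> * exp (- (r / 2) * t))\<^sup>2"
        by (simp add: power_mult_distrib flip: exp_double)
      finally show ?thesis
        by (rule power2_le_imp_le) simp
    qed
    moreover have "0 \<le> sqrt \<bar>C\<bar>" "0 < r / 2"
      using r by simp_all
    ultimately show ?thesis
      unfolding converges_exponentially_def by blast
  qed
  then show ?thesis
    using sol init uniq by (intro exI[of _ x] exI[of _ v]) blast
qed

end
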